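(* Let $a,b\in\mathbb N$ and $m\in\mathbb Z$. Then in the modified quantum group $\dot{\mathbf U}$ of $\mathfrak{sl}_2$, $$E^{(a)}F^{(b)}\mathbf 1_m=\sum_{s=0}^{\min(a,b)}\frac{q^{-s^2+s(a-b+m)}}{(q^{-2};q^{-2})_s}\,\mathfrak w_m(a-s,b-s),\qquad\text{for }m\le b-a,$$ $$F^{(b)}E^{(a)}\mathbf 1_m=\sum_{s=0}^{\min(a,b)}\frac{q^{-s^2-s(a-b+m)}}{(q^{-2};q^{-2})_s}\,\mathfrak w_m(a-s,b-s),\qquad\text{for }m\ge b-a.$$
   Context: $\mathbf U=\mathbf U_q(\mathfrak{sl}_2)$ is the $\mathbb Q(q)$-algebra generated by $E,F,K^{\pm1}$ with $KE=q^2EK$, $KF=q^{-2}FK$, $EF-FE=(K-K^{-1})/(q-q^{-1})$ and comultiplication $\Delta(K)=K\otimes K$, $\Delta(E)=E\otimes1+K\otimes E$, $\Delta(F)=F\otimes K^{-1}+1\otimes F$. $\mathbf U^+,\mathbf U^-$ are the subalgebras generated by $E$, resp. $F$. $E^{(a)}=E^a/[a]!$, $F^{(a)}=F^a/[a]!$ with $[a]!=\prod_{k=1}^a\frac{q^k-q^{-k}}{q-q^{-1}}$. The weight lattice is $X=\mathbb Z$, $X^+=\mathbb N=\{0,1,2,\dots\}$. $\dot{\mathbf U}$ is Lusztig's modified quantum group, with orthogonal idempotents $\mathbf 1_m$ ($m\in\mathbb Z$), $K\mathbf 1_m=q^m\mathbf 1_m$, $E\mathbf 1_m=\mathbf 1_{m+2}E$,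 $F\mathbf 1_m=\mathbf 1_{m-2}F$; it acts on weight modules, $\mathbf 1_m$ acting as projection to the weight space where $K=q^m$. For $n\in\mathbb N$, $L(n)$ is the $(n+1)$-dimensional simple module with highest weight vector $\eta_n$ of weight $n$, and ${}^\omega L(n)$ the simple module with lowest weight vector $\xi_{-n}$ of weight $-n$. $(q^{-2};q^{-2})_s=\prod_{k=1}^s(1-q^{-2k})$. For fixed $m\in\mathbb Z$, a sequence $z_p\in{}^\omega L(p)\otimes L(p+m)$ (indexed by $p\in\mathbb N$ with $p+m\in\mathbb N$) is written $o(1)$ (asymptotically zero) if it can be written as a linear combination of elements $u\mathbf 1_m(\xi_{-p}\otimes\eta_{p+m})$ ($u\in\dot{\mathbf U}$) and $x\xi_{-p}\otimes y\eta_{p+m}$ ($(x,y)\in\mathbf U^+\times\mathbf U^-$), with $u$ and $(x,y)$ running over finite sets independent of $p$, with coefficients finite sums $\sum_{s\ge1}f_s(q)q^{-2sp}$, $f_s(q)\in\mathbb Q(q)$ independent of $p$. For $a,b\in\mathbb N$, $m\in\mathbb Z$, $\mathfrak w_m(a,b)$ is the unique element of $\dot{\mathbf U}\mathbf 1_m$ such that $\mathfrak w_m(a,b)(\xi_{-p}\otimes\eta_{p+m})-E^{(a)}\xi_{-p}\otimes F^{(b)}\eta_{p+m}=o(1)$ (existence and uniqueness are established beforehand in the paper). *)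

theory Defs
  imports "HOL-Library.Poly_Mapping" "HOL-Computational_Algebra.Computational_Algebra"
begin

section \<open>The ground field\<close>

type_synonym Qq = "rat poly fract"

definition q :: Qq where "q = to_fract [:0, 1:]"

definition qint :: "nat \<Rightarrow> Qq" where
  "qint k = (q powi int k - q powi (- int k)) / (q - inverse q)"

definition qfact :: "nat \<Rightarrow> Qq" where
  "qfact a = (\<Prod>k=1..a. qint k)"

definition qpoch :: "nat \<Rightarrow> Qq" \<comment> \<open>the q-Pochhammer symbol \<open>(q\<^sup>-\<^sup>2; q\<^sup>-\<^sup>2)\<^sub>s\<close>\<close> where
  "qpoch s = (\<Prod>k=1..s. 1 - q powi (- (2 * int k)))"

lemma q_power_eq: "q ^ n = to_fract (monom 1 n)"
  by (induction n) (simp_all add: q_def monom_Suc flip: to_fract_mult)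

lemma q_nonzero [simp]: "q \<noteq> 0"
  by (simp add: q_def)

lemma q_power_inj: "q ^ m = q ^ n \<longleftrightarrow> m = n"
  by (simp add: q_power_eq monom_eq_iff')

lemma q_powi_inj: "q powi a = q powi b \<longleftrightarrow> a = b"
proof
  assume eq: "q powi a = q powi b"
  define c where "c = max \<bar>a\<bar> \<bar>b\<bar>"
  have "q powi (a + c) = q powi (b + c)"
    using eq by (simp add: power_int_add)
  moreover have "a + c \<ge> 0" "b + c \<ge> 0" by (auto simp: c_def)
  ultimately have "q ^ nat (a + c) = q ^ nat (b + c)"
    by (simp add: power_int_def)
  then show "a = b" using \<open>a + c \<ge> 0\<close> \<open>b + c \<ge> 0\<close> by (simp add: q_power_inj)
qed simp

lemma q_diff_nonzero [simp]: "q - inverse q \<noteq> 0" "q \<noteq> inverse q"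
  using q_powi_inj[of 1 "-1"] by (simp_all add: power_int_minus)

lemma qint_nonzero: "n > 0 \<Longrightarrow> qint n \<noteq> 0"
  using q_powi_inj[of "int n" "- int n"] by (simp add: qint_def)


section \<open>Free vector spaces and their tensor products\<close>

abbreviation lookup :: "('b \<Rightarrow>\<^sub>0 Qq) \<Rightarrow> 'b \<Rightarrow> Qq" where
  "lookup \<equiv> Poly_Mapping.lookup"

abbreviation keys :: "('b \<Rightarrow>\<^sub>0 Qq) \<Rightarrow> 'b set" where
  "keys \<equiv> Poly_Mapping.keys"

definition scale :: "Qq \<Rightarrow> ('b \<Rightarrow>\<^sub>0 Qq) \<Rightarrow> ('b \<Rightarrow>\<^sub>0 Qq)" where
  "scale c v = Poly_Mapping.map ((*) c) v"

lemma lookup_scale [simp]: "lookup (scale c v) b = c * lookup v b"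
  by (simp add: scale_def Poly_Mapping.map.rep_eq when_def)

global_interpretation pm: vector_space scale
  by unfold_locales (auto intro!: poly_mapping_eqI simp: lookup_add algebra_simps)

definition bvec :: "'b \<Rightarrow> ('b \<Rightarrow>\<^sub>0 Qq)" where
  "bvec b = Poly_Mapping.single b 1"

text \<open>The linear extension of a map given on the basis.\<close>

definition lin :: "('b \<Rightarrow> ('c \<Rightarrow>\<^sub>0 Qq)) \<Rightarrow> ('b \<Rightarrow>\<^sub>0 Qq) \<Rightarrow> ('c \<Rightarrow>\<^sub>0 Qq)" where
  "lin f v = (\<Sum>b\<in>keys v. scale (lookup v b) (f b))"

definition tens :: "('b \<Rightarrow>\<^sub>0 Qq) \<Rightarrow> ('c \<Rightarrow>\<^sub>0 Qq) \<Rightarrow> ('b \<times> 'c \<Rightarrow>\<^sub>0 Qq)" where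
  "tens x y = (\<Sum>b\<in>keys x. \<Sum>c\<in>keys y. Poly_Mapping.single (b, c) (lookup x b * lookup y c))"

lemma lin_superset:
  assumes "finite S" "keys v \<subseteq> S"
  shows "lin f v = (\<Sum>b\<in>S. scale (lookup v b) (f b))"
  unfolding lin_def
  by (rule sum.mono_neutral_left) (use assms in \<open>auto simp: in_keys_iff\<close>)

lemma lin_add: "lin f (v + w) = lin f v + lin f w"
proof -
  define S where "S = keys v \<union> keys w"
  have S: "finite S" "keys v \<subseteq> S" "keys w \<subseteq> S" "keys (v + w) \<subseteq> S"
    using keys_add[of v w] by (auto simp: S_def)
  show ?thesis
    by (simp add: lin_superset[OF S(1)] S lookup_add pm.scale_left_distrib sum.distrib)
qed

lemma lin_scale: "lin f (scale c v) = scale c (lin f v)"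
proof -
  have S: "finite (keys v)" "keys (scale c v) \<subseteq> keys v" by (auto simp: in_keys_iff)
  show ?thesis
    by (simp add: lin_superset[OF S(1)] S pm.scale_sum_right)
qed

lemma linear_lin: "Vector_Spaces.linear scale scale (lin f)"
  by unfold_locales (simp_all add: lin_add lin_scale)

lemma lin_zero [simp]: "lin f 0 = 0"
  by (simp add: lin_def)

lemma lin_bvec [simp]: "lin f (bvec b) = f b"
  by (simp add: lin_def bvec_def)

lemma lin_diff: "lin f (v - w) = lin f v - lin f w"
  using lin_add[of f "v - w" w] by simp

lemma lin_sum: "lin f (sum g S) = (\<Sum>i\<in>S. lin f (g i))"
  by (induction S rule: infinite_finite_induct) (simp_all add: lin_add)

lemma lin_fun_add: "lin (\<lambda>b. f b + g b) v = lin f v + lin g v"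
  by (simp add: lin_def pm.scale_right_distrib sum.distrib)

lemma lin_bvec_id [simp]: "lin bvec v = v"
  by (rule poly_mapping_eqI)
    (auto simp: lin_def bvec_def lookup_sum lookup_single when_def in_keys_iff if_distrib cong: if_cong)

lemma lin_lin: "lin f (lin g v) = lin (\<lambda>b. lin f (g b)) v"
  by (simp add: lin_def[of g] lin_def[of "\<lambda>b. lin f (g b)"] lin_sum lin_scale)

lemma lin_cong: "(\<And>b. b \<in> keys v \<Longrightarrow> f b = g b) \<Longrightarrow> lin f v = lin g v"
  by (simp add: lin_def)

lemma lookup_tens [simp]: "lookup (tens x y) (b, c) = lookup x b * lookup y c"
proof -
  have "lookup (tens x y) (b, c) =
    (\<Sum>b'\<in>keys x. \<Sum>c'\<in>keys y. if b' = b \<and> c' = c then lookup x b' * lookup y c' else 0)"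
    by (simp add: tens_def lookup_sum lookup_single when_def)
  also have "\<dots> = (\<Sum>b'\<in>keys x. if b' = b then lookup x b' * lookup y c else 0)"
    by (rule sum.cong) (auto simp: in_keys_iff)
  also have "\<dots> = lookup x b * lookup y c"
    by (auto simp: in_keys_iff)
  finally show ?thesis .
qed

lemma poly_mapping_pair_eqI: "(\<And>b c. lookup v (b, c) = lookup w (b, c)) \<Longrightarrow> v = w"
  by (rule poly_mapping_eqI) auto

lemma tens_simps:
  "tens (x + x') y = tens x y + tens x' y" "tens x (y + y') = tens x y + tens x y'"
  "tens (x - x') y = tens x y - tens x' y" "tens x (y - y') = tens x y - tens x y'"
  "tens (scale c x) y = scale c (tens x y)" "tens x (scale c y) = scale c (tens x y)"
  by (auto intro!: poly_mapping_pair_eqI simp: lookup_add lookup_minus algebra_simps)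

lemma tens_zero [simp]: "tens 0 y = 0" "tens x 0 = 0"
  by (simp_all add: tens_def)

lemma tens_bvec [simp]: "tens (bvec b) (bvec c) = bvec (b, c)"
  by (rule poly_mapping_pair_eqI) (auto simp: bvec_def lookup_single when_def)

lemma tens_sum_left: "tens (sum f S) y = (\<Sum>i\<in>S. tens (f i) y)"
  by (induction S rule: infinite_finite_induct) (simp_all add: tens_simps)

lemma tens_sum_right: "tens x (sum f S) = (\<Sum>i\<in>S. tens x (f i))"
  by (induction S rule: infinite_finite_induct) (simp_all add: tens_simps)

lemma tens_lin: "tens (lin f x) (lin g y) = lin (\<lambda>(b, c). tens (f b) (g c)) (tens x y)"
proof -
  have "keys (tens x y) \<subseteq> keys x \<times> keys y" by (auto simp: in_keys_iff)
  then have "lin (\<lambda>(b, c). tens (f b) (g c)) (tens x y) =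
    (\<Sum>z\<in>keys x \<times> keys y. scale (lookup (tens x y) z) (case z of (b, c) \<Rightarrow> tens (f b) (g c)))"
    by (intro lin_superset) auto
  also have "\<dots> = (\<Sum>b\<in>keys x. \<Sum>c\<in>keys y. scale (lookup x b * lookup y c) (tens (f b) (g c)))"
    by (subst sum.cartesian_product) (auto intro!: sum.cong)
  also have "\<dots> = tens (lin f x) (lin g y)"
    by (simp add: lin_def tens_sum_left tens_sum_right tens_simps mult.commute
        pm.scale_sum_right sum.swap[of _ "keys y" "keys x"])
  finally show ?thesis by simp
qed


section \<open>The quantum group with idempotents\<close>

inductive_set two_sided_ideal :: "'a::ring_1 set \<Rightarrow> 'a set" for S where
  zero: "0 \<in> two_sided_ideal S"
| base: "s \<in> S \<Longrightarrow> x * s * y \<in> two_sided_ideal S"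
| add: "x \<in> two_sided_ideal S \<Longrightarrow> y \<in> two_sided_ideal S \<Longrightarrow> x + y \<in> two_sided_ideal S"

lemma two_sided_ideal_mult:
  assumes "x \<in> two_sided_ideal S"
  shows "y * x * z \<in> two_sided_ideal S"
  using assms
proof induction
  case (base s a b)
  have "(y * a) * s * (b * z) \<in> two_sided_ideal S" using base by (rule two_sided_ideal.base)
  then show ?case by (simp add: mult.assoc)
qed (simp_all add: two_sided_ideal.zero two_sided_ideal.add distrib_left distrib_right)

lemma two_sided_ideal_multl: "x \<in> two_sided_ideal S \<Longrightarrow> y * x \<in> two_sided_ideal S"
  using two_sided_ideal_mult[of x S y 1] by simp

lemma two_sided_ideal_multr: "x \<in> two_sided_ideal S \<Longrightarrow> x * y \<in> two_sided_ideal S"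
  using two_sided_ideal_mult[of x S 1 y] by simp

lemma two_sided_ideal_uminus: "x \<in> two_sided_ideal S \<Longrightarrow> - x \<in> two_sided_ideal S"
  using two_sided_ideal_multl[of x S "-1"] by simp

datatype ugen = GenE | GenF | GenK | GenKinv | GenIdem int

datatype uword = Word (letters: "ugen list")

instantiation uword :: monoid_add
begin
definition "0 = Word []"
definition "v + w = Word (letters v @ letters w)"
instance by standard (simp_all add: zero_uword_def plus_uword_def)
end

text \<open>The monoid algebra of the free monoid, i.e. the free associative unital algebra on the
  generators; its multiplication is the convolution product of the library.\<close>

type_synonym free_alg = "uword \<Rightarrow>\<^sub>0 Qq"

definition fg :: "ugen \<Rightarrow> free_alg" where "fg g = Poly_Mapping.single (Word [g]) 1"
definition fc :: "Qq \<Rightarrow> free_alg" where "fc c = Poly_Mapping.single 0 c"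

definition urels :: "free_alg set" where
  "urels =
    {fg GenK * fg GenKinv - 1,
     fg GenKinv * fg GenK - 1,
     fg GenK * fg GenE - fc (q ^ 2) * fg GenE * fg GenK,
     fg GenK * fg GenF - fc (q powi (-2)) * fg GenF * fg GenK,
     fg GenE * fg GenF - fg GenF * fg GenE
       - fc (1 / (q - inverse q)) * (fg GenK - fg GenKinv)}
    \<union> {fg (GenIdem m) * fg (GenIdem n) - (if m = n then fg (GenIdem m) else 0) | m n. True}
    \<union> {fg GenK * fg (GenIdem m) - fc (q powi m) * fg (GenIdem m) | m. True}
    \<union> {fg (GenIdem m) * fg GenK - fc (q powi m) * fg (GenIdem m) | m. True}
    \<union> {fg GenE * fg (GenIdem m) - fg (GenIdem (m + 2)) * fg GenE | m. True}
    \<union> {fg GenF * fg (GenIdem m) - fg (GenIdem (m - 2)) * fg GenF | m. True}"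

text \<open>
  The type \<open>uq\<close> is the algebra obtained from \<open>U\<close> by adjoining the orthogonal idempotents
  \<open>1\<^sub>m\<close>, subject to \<open>K 1\<^sub>m = 1\<^sub>m K = q\<^sup>m 1\<^sub>m\<close>, \<open>E 1\<^sub>m = 1\<^bsub>m+2\<^esub> E\<close>, \<open>F 1\<^sub>m = 1\<^bsub>m-2\<^esub> F\<close>
  and keeping the old unit.  As a vector space it is the direct sum of \<open>U\<close> (the subalgebra
  generated by \<open>E, F, K, K\<inverse>\<close>) and of the modified quantum group (the two-sided ideal
  generated by the \<open>1\<^sub>m\<close>), so that products such as \<open>E\<^sup>(\<^sup>a\<^sup>) F\<^sup>(\<^sup>b\<^sup>) 1\<^sub>m\<close>, which use the
  \<open>U\<close>-bimodule structure of the modified quantum group, are ordinary products in \<open>uq\<close>.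
\<close>

quotient_type uq = free_alg / "\<lambda>x y. x - y \<in> two_sided_ideal urels"
proof (rule equivpI)
  show "reflp (\<lambda>x y. x - y \<in> two_sided_ideal urels)"
    by (rule reflpI) (simp add: two_sided_ideal.zero)
  show "symp (\<lambda>x y. x - y \<in> two_sided_ideal urels)"
    by (rule sympI) (drule two_sided_ideal_uminus, simp)
  show "transp (\<lambda>x y. x - y \<in> two_sided_ideal urels)"
    by (rule transpI) (drule (1) two_sided_ideal.add, simp)
qed

text \<open>Operators on a subspace that satisfy the relations; the trivial representation
  shows that the quotient is not the zero ring.\<close>

definition word_op :: "(ugen \<Rightarrow> ('b \<Rightarrow>\<^sub>0 Qq) \<Rightarrow> ('b \<Rightarrow>\<^sub>0 Qq)) \<Rightarrow> uword \<Rightarrow> ('b \<Rightarrow>\<^sub>0 Qq) \<Rightarrow> ('b \<Rightarrow>\<^sub>0 Qq)" where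
  "word_op f w = foldr f (letters w)"

definition free_op :: "(ugen \<Rightarrow> ('b \<Rightarrow>\<^sub>0 Qq) \<Rightarrow> ('b \<Rightarrow>\<^sub>0 Qq)) \<Rightarrow> free_alg \<Rightarrow> ('b \<Rightarrow>\<^sub>0 Qq) \<Rightarrow> ('b \<Rightarrow>\<^sub>0 Qq)" where
  "free_op f x v = lin (\<lambda>w. word_op f w v) x"

lemma free_alg_sum: "x = (\<Sum>w\<in>keys x. Poly_Mapping.single w (lookup x w))"
  by (rule poly_mapping_eqI) (auto simp: lookup_sum lookup_single when_def in_keys_iff)

lemma lin_single: "lin f (Poly_Mapping.single w c) = scale c (f w)"
  by (cases "c = 0") (simp_all add: lin_def)

locale linear_ops =
  fixes f :: "ugen \<Rightarrow> ('b \<Rightarrow>\<^sub>0 Qq) \<Rightarrow> ('b \<Rightarrow>\<^sub>0 Qq)" and C :: "('b \<Rightarrow>\<^sub>0 Qq) set"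
  assumes subspace: "pm.subspace C"
    and closed: "v \<in> C \<Longrightarrow> f g v \<in> C"
    and add: "v \<in> C \<Longrightarrow> w \<in> C \<Longrightarrow> f g (v + w) = f g v + f g w"
    and scale: "v \<in> C \<Longrightarrow> f g (scale c v) = scale c (f g v)"
begin

lemma word_op_closed: "v \<in> C \<Longrightarrow> word_op f w v \<in> C"
proof -
  have "v \<in> C \<Longrightarrow> foldr f xs v \<in> C" for xs by (induction xs) (simp_all add: closed)
  then show "v \<in> C \<Longrightarrow> word_op f w v \<in> C" by (simp add: word_op_def)
qed

lemma word_op_add: "v \<in> C \<Longrightarrow> v' \<in> C \<Longrightarrow> word_op f w (v + v') = word_op f w v + word_op f w v'"
proof -
  have "v \<in> C \<Longrightarrow> v' \<in> C \<Longrightarrow> foldr f xs (v + v') = foldr f xs v + foldr f xs v'" for xs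
    by (induction xs) (simp_all add: add word_op_closed[of _ "Word _", unfolded word_op_def, simplified])
  then show "v \<in> C \<Longrightarrow> v' \<in> C \<Longrightarrow> word_op f w (v + v') = word_op f w v + word_op f w v'"
    by (simp add: word_op_def)
qed

lemma word_op_scale: "v \<in> C \<Longrightarrow> word_op f w (scale c v) = scale c (word_op f w v)"
proof -
  have "v \<in> C \<Longrightarrow> foldr f xs (scale c v) = scale c (foldr f xs v)" for xs
    by (induction xs) (simp_all add: scale word_op_closed[of _ "Word _", unfolded word_op_def, simplified])
  then show "v \<in> C \<Longrightarrow> word_op f w (scale c v) = scale c (word_op f w v)"
    by (simp add: word_op_def)
qed

lemma word_op_sum:
  "(\<And>i. i \<in> S \<Longrightarrow> g i \<in> C) \<Longrightarrow> word_op f w (sum g S) = (\<Sum>i\<in>S. word_op f w (g i))"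
proof (induction S rule: infinite_finite_induct)
  case (insert i S)
  then show ?case by (simp add: word_op_add pm.subspace_sum[OF subspace])
qed (use word_op_scale[of 0 w 0] pm.subspace_0[OF subspace] in simp_all)

lemma free_op_closed: "v \<in> C \<Longrightarrow> free_op f x v \<in> C"
  unfolding free_op_def lin_def
  by (intro pm.subspace_sum[OF subspace] pm.subspace_scale[OF subspace] word_op_closed)

lemma free_op_linear:
  "v \<in> C \<Longrightarrow> v' \<in> C \<Longrightarrow> free_op f x (v + v') = free_op f x v + free_op f x v'"
  "v \<in> C \<Longrightarrow> free_op f x (scale c v) = scale c (free_op f x v)"
  by (simp_all add: free_op_def lin_def word_op_add word_op_scale pm.scale_right_distrib
      sum.distrib pm.scale_sum_right mult.commute)

lemma free_op_mult:
  assumes v: "v \<in> C"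
  shows "free_op f (x * y) v = free_op f x (free_op f y v)"
proof -
  have "x * y = (\<Sum>w\<in>keys x. \<Sum>w'\<in>keys y. Poly_Mapping.single (w + w') (lookup x w * lookup y w'))"
    by (subst free_alg_sum[of x], subst free_alg_sum[of y]) (simp add: sum_product mult_single)
  then have "free_op f (x * y) v = (\<Sum>w\<in>keys x. \<Sum>w'\<in>keys y.
      scale (lookup x w * lookup y w') (word_op f w (word_op f w' v)))"
    by (simp add: free_op_def lin_sum lin_single) (simp add: word_op_def plus_uword_def)
  also have "\<dots> = free_op f x (free_op f y v)"
    by (simp add: free_op_def lin_def word_op_sum word_op_scale v word_op_closed
        pm.subspace_scale[OF subspace] pm.scale_sum_right)
  finally show ?thesis .
qed

end

lemma free_op_simps:
  "free_op f (x + y) v = free_op f x v + free_op f y v"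
  "free_op f (x - y) v = free_op f x v - free_op f y v"
  "free_op f 0 v = 0" "free_op f 1 v = v" "free_op f (fg g) v = f g v"
  "free_op f (fc c) v = scale c v"
  by (simp_all add: free_op_def lin_add lin_diff fg_def fc_def lin_single word_op_def zero_uword_def
      flip: single_one)

lemma (in linear_ops) ideal_annihilates:
  assumes "\<And>r v. r \<in> R \<Longrightarrow> v \<in> C \<Longrightarrow> free_op f r v = 0"
  shows "x \<in> two_sided_ideal R \<Longrightarrow> v \<in> C \<Longrightarrow> free_op f x v = 0"
proof (induction rule: two_sided_ideal.induct)
  case (base s x y)
  then show ?case
    using free_op_linear(2)[of 0 x 0] pm.subspace_0[OF subspace]
    by (simp add: free_op_mult free_op_closed assms)
qed (simp_all add: free_op_simps)

lemma one_notin_ideal: "1 \<notin> two_sided_ideal urels"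
proof
  define f :: "ugen \<Rightarrow> (unit \<Rightarrow>\<^sub>0 Qq) \<Rightarrow> (unit \<Rightarrow>\<^sub>0 Qq)"
    where "f g v = (if g \<in> {GenK, GenKinv} then v else 0)" for g v
  interpret linear_ops f UNIV
    by unfold_locales (simp_all add: f_def)
  assume "1 \<in> two_sided_ideal urels"
  then have "free_op f 1 (bvec ()) = 0"
    by (rule ideal_annihilates[rotated])
      (auto simp: urels_def free_op_simps free_op_mult f_def split: if_splits)
  then have "lookup (bvec ()) () = 0" by (simp add: free_op_simps)
  then show False by (simp add: bvec_def)
qed

instantiation uq :: ring_1
begin

lift_definition zero_uq :: uq is 0 .
lift_definition one_uq :: uq is 1 .

lift_definition plus_uq :: "uq \<Rightarrow> uq \<Rightarrow> uq" is "(+)"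
  by (simp add: add_diff_add two_sided_ideal.add)

lift_definition uminus_uq :: "uq \<Rightarrow> uq" is uminus
  by (drule two_sided_ideal_uminus) simp

lift_definition minus_uq :: "uq \<Rightarrow> uq \<Rightarrow> uq" is "(-)"
proof -
  fix a b c d :: free_alg
  assume "a - b \<in> two_sided_ideal urels" "c - d \<in> two_sided_ideal urels"
  then have "(a - b) + - (c - d) \<in> two_sided_ideal urels"
    by (intro two_sided_ideal.add two_sided_ideal_uminus)
  then show "a - c - (b - d) \<in> two_sided_ideal urels" by (simp add: algebra_simps)
qed

lift_definition times_uq :: "uq \<Rightarrow> uq \<Rightarrow> uq" is "(*)"
proof -
  fix a b c d :: free_alg
  assume "a - b \<in> two_sided_ideal urels" "c - d \<in> two_sided_ideal urels"
  then have "(a - b) * c + b * (c - d) \<in> two_sided_ideal urels"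
    by (intro two_sided_ideal.add two_sided_ideal_multl two_sided_ideal_multr)
  then show "a * c - b * d \<in> two_sided_ideal urels" by (simp add: algebra_simps)
qed

instance
proof
  show "(0 :: uq) \<noteq> 1"
    by transfer (use one_notin_ideal two_sided_ideal_uminus[of "-1"] in auto)
qed (transfer; simp add: algebra_simps two_sided_ideal.zero)+

end

lift_definition scal :: "Qq \<Rightarrow> uq" is fc .
lift_definition uE :: uq is "fg GenE" .
lift_definition uF :: uq is "fg GenF" .
lift_definition uK :: uq is "fg GenK" .
lift_definition uKinv :: uq is "fg GenKinv" .
lift_definition idem :: "int \<Rightarrow> uq" is "\<lambda>m. fg (GenIdem m)" .

lemma scal_simps:
  "scal (c + d) = scal c + scal d" "scal (c * d) = scal c * scal d" "scal 0 = 0" "scal 1 = 1"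
  by (transfer; simp add: fc_def single_add mult_single two_sided_ideal.zero flip: single_one)+

lemma fc_commute: "fc c * x = x * fc c"
  unfolding fc_def
  by (subst (1 2) free_alg_sum)
    (simp add: sum_distrib_left sum_distrib_right mult_single mult.commute)

lemma scal_commute: "scal c * x = x * scal c"
  by transfer (simp add: fc_commute two_sided_ideal.zero)

lemma uq_relations:
  "uK * uKinv = 1" "uKinv * uK = 1"
  "uK * uE = scal (q ^ 2) * uE * uK"
  "uK * uF = scal (q powi (-2)) * uF * uK"
  "uE * uF - uF * uE = scal (1 / (q - inverse q)) * (uK - uKinv)"
  "idem m * idem n = (if m = n then idem m else 0)"
  "uK * idem m = scal (q powi m) * idem m"
  "idem m * uK = scal (q powi m) * idem m"
  "uE * idem m = idem (m + 2) * uE"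
  "uF * idem m = idem (m - 2) * uF"
proof -
  have R: "x - y \<in> two_sided_ideal urels" if "x - y \<in> urels" for x y
    using two_sided_ideal.base[OF that, of 1 1] by simp
  show "uK * uKinv = 1" by transfer (rule R, auto simp: urels_def)
  show "uKinv * uK = 1" by transfer (rule R, auto simp: urels_def)
  show "uK * uE = scal (q ^ 2) * uE * uK" by transfer (rule R, auto simp: urels_def)
  show "uK * uF = scal (q powi (-2)) * uF * uK" by transfer (rule R, auto simp: urels_def)
  show "uE * uF - uF * uE = scal (1 / (q - inverse q)) * (uK - uKinv)"
    by transfer (rule R, auto simp: urels_def)
  have "idem m * idem m = idem m" by transfer (rule R, unfold urels_def, force)
  moreover have "idem m * idem n = 0" if "m \<noteq> n"
    using that by transfer (rule R, unfold urels_def, force)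
  ultimately show "idem m * idem n = (if m = n then idem m else 0)" by auto
  show "uK * idem m = scal (q powi m) * idem m" by transfer (rule R, auto simp: urels_def)
  show "idem m * uK = scal (q powi m) * idem m" by transfer (rule R, auto simp: urels_def)
  show "uE * idem m = idem (m + 2) * uE" by transfer (rule R, auto simp: urels_def)
  show "uF * idem m = idem (m - 2) * uF" by transfer (rule R, auto simp: urels_def)
qed

inductive_set subalgebra :: "uq set \<Rightarrow> uq set" for S where
  scal: "scal c \<in> subalgebra S"
| gen: "x \<in> S \<Longrightarrow> x \<in> subalgebra S"
| add: "x \<in> subalgebra S \<Longrightarrow> y \<in> subalgebra S \<Longrightarrow> x + y \<in> subalgebra S"
| mult: "x \<in> subalgebra S \<Longrightarrow> y \<in> subalgebra S \<Longrightarrow> x * y \<in> subalgebra S"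

definition Uplus :: "uq set" where "Uplus = subalgebra {uE}"
definition Uminus :: "uq set" where "Uminus = subalgebra {uF}"

definition Udot :: "uq set" where
  "Udot = two_sided_ideal {idem m | m. True}"

definition Udot_idem :: "int \<Rightarrow> uq set" where
  "Udot_idem m = {u * idem m | u. u \<in> Udot}"

definition divE :: "nat \<Rightarrow> uq" where "divE a = scal (inverse (qfact a)) * uE ^ a"
definition divF :: "nat \<Rightarrow> uq" where "divF b = scal (inverse (qfact b)) * uF ^ b"


section \<open>Weight modules\<close>

text \<open>A module with a chosen basis, given by the values of \<open>E, F, K, K\<inverse>\<close> on basis vectors.\<close>

record 'b umod =
  basis :: "'b set"
  opE :: "'b \<Rightarrow> ('b \<Rightarrow>\<^sub>0 Qq)"
  opF :: "'b \<Rightarrow> ('b \<Rightarrow>\<^sub>0 Qq)"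
  opK :: "'b \<Rightarrow> ('b \<Rightarrow>\<^sub>0 Qq)"
  opKinv :: "'b \<Rightarrow> ('b \<Rightarrow>\<^sub>0 Qq)"

definition carrier :: "'b umod \<Rightarrow> ('b \<Rightarrow>\<^sub>0 Qq) set" where
  "carrier M = {v. keys v \<subseteq> basis M}"

definition umodule :: "'b umod \<Rightarrow> bool" where
  "umodule M \<longleftrightarrow> (\<forall>b\<in>basis M.
     opE M b \<in> carrier M \<and> opF M b \<in> carrier M \<and> opK M b \<in> carrier M \<and> opKinv M b \<in> carrier M \<and>
     lin (opK M) (opKinv M b) = bvec b \<and>
     lin (opKinv M) (opK M b) = bvec b \<and>
     lin (opK M) (opE M b) = scale (q ^ 2) (lin (opE M) (opK M b)) \<and>
     lin (opK M) (opF M b) = scale (q powi (-2)) (lin (opF M) (opK M b)) \<and>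
     lin (opE M) (opF M b) - lin (opF M) (opE M b) =
       scale (1 / (q - inverse q)) (opK M b - opKinv M b))"

definition wt_space :: "'b umod \<Rightarrow> int \<Rightarrow> ('b \<Rightarrow>\<^sub>0 Qq) set" where
  "wt_space M m = {v \<in> carrier M. lin (opK M) v = scale (q powi m) v}"

definition weight_module :: "'b umod \<Rightarrow> bool" where
  "weight_module M \<longleftrightarrow> umodule M \<and> carrier M \<subseteq> pm.span (\<Union>m. wt_space M m)"

text \<open>The projection onto a weight space along the sum of the other weight spaces.\<close>

definition wt_proj :: "'b umod \<Rightarrow> int \<Rightarrow> ('b \<Rightarrow>\<^sub>0 Qq) \<Rightarrow> ('b \<Rightarrow>\<^sub>0 Qq)" where
  "wt_proj M m v = (THE w. w \<in> wt_space M m \<and> v - w \<in> pm.span (\<Union>k\<in>-{m}. wt_space M k))"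

primrec gen_op :: "'b umod \<Rightarrow> ugen \<Rightarrow> ('b \<Rightarrow>\<^sub>0 Qq) \<Rightarrow> ('b \<Rightarrow>\<^sub>0 Qq)" where
  "gen_op M GenE = lin (opE M)"
| "gen_op M GenF = lin (opF M)"
| "gen_op M GenK = lin (opK M)"
| "gen_op M GenKinv = lin (opKinv M)"
| "gen_op M (GenIdem m) = wt_proj M m"

text \<open>The choice of a representative is immaterial for vectors of the carrier of a weight module;
  see \<open>act_abs\<close> below.\<close>

definition act :: "'b umod \<Rightarrow> uq \<Rightarrow> ('b \<Rightarrow>\<^sub>0 Qq) \<Rightarrow> ('b \<Rightarrow>\<^sub>0 Qq)" where
  "act M u v = free_op (gen_op M) (rep_uq u) v"

lemma subspace_carrier: "pm.subspace (carrier M)"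
proof (rule pm.subspaceI)
  fix x y assume "x \<in> carrier M" "y \<in> carrier M"
  then show "x + y \<in> carrier M" using keys_add[of x y] by (auto simp: carrier_def)
next
  fix c x assume "x \<in> carrier M"
  moreover have "keys (scale c x) \<subseteq> keys x" by (auto simp: in_keys_iff)
  ultimately show "scale c x \<in> carrier M" by (auto simp: carrier_def)
qed (simp add: carrier_def)

lemma subspace_wt_space: "pm.subspace (wt_space M m)"
  using subspace_carrier[of M]
  by (auto intro!: pm.subspaceI simp: wt_space_def lin_add lin_scale pm.scale_right_distrib
      pm.scale_left_commute pm.subspace_0 pm.subspace_add pm.subspace_scale)

lemma bvec_carrier: "b \<in> basis M \<Longrightarrow> bvec b \<in> carrier M"
  by (simp add: carrier_def bvec_def)

lemma lin_carrier:
  assumes "\<And>b. b \<in> basis M \<Longrightarrow> f b \<in> carrier M" "v \<in> carrier M"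
  shows "lin f v \<in> carrier M"
  unfolding lin_def
  by (intro pm.subspace_sum pm.subspace_scale subspace_carrier) (use assms in \<open>auto simp: carrier_def\<close>)

lemma lin_eq_carrier:
  assumes "\<And>b. b \<in> basis M \<Longrightarrow> f b = g b" "v \<in> carrier M"
  shows "lin f v = lin g v"
  by (rule lin_cong) (use assms in \<open>auto simp: carrier_def\<close>)

lemma umodule_closed:
  assumes "umodule M" "v \<in> carrier M"
  shows "lin (opE M) v \<in> carrier M" "lin (opF M) v \<in> carrier M"
    "lin (opK M) v \<in> carrier M" "lin (opKinv M) v \<in> carrier M"
  using assms by (auto intro!: lin_carrier simp: umodule_def)

lemma lin_fun_scale: "lin (\<lambda>b. scale c (f b)) v = scale c (lin f v)"
  by (simp add: lin_def pm.scale_sum_right mult.commute)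

lemma lin_fun_diff: "lin (\<lambda>b. f b - g b) v = lin f v - lin g v"
  by (simp add: lin_def pm.scale_right_diff_distrib sum_subtractf)

lemma umodule_relations:
  assumes M: "umodule M" and v: "v \<in> carrier M"
  shows "lin (opK M) (lin (opKinv M) v) = v"
    "lin (opKinv M) (lin (opK M) v) = v"
    "lin (opK M) (lin (opE M) v) = scale (q ^ 2) (lin (opE M) (lin (opK M) v))"
    "lin (opK M) (lin (opF M) v) = scale (q powi (-2)) (lin (opF M) (lin (opK M) v))"
    "lin (opE M) (lin (opF M) v) - lin (opF M) (lin (opE M) v) =
       scale (1 / (q - inverse q)) (lin (opK M) v - lin (opKinv M) v)"
proof -
  have L: "lin f v = lin g v" if "\<And>b. b \<in> basis M \<Longrightarrow> f b = g b" for f g :: "'a \<Rightarrow> 'a \<Rightarrow>\<^sub>0 Qq"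
    using that v by (rule lin_eq_carrier)
  have "lin (\<lambda>b. lin (opK M) (opKinv M b)) v = lin bvec v"
    by (rule L) (use M in \<open>unfold umodule_def, blast\<close>)
  then show "lin (opK M) (lin (opKinv M) v) = v" by (simp only: lin_lin lin_bvec_id)
  have "lin (\<lambda>b. lin (opKinv M) (opK M b)) v = lin bvec v"
    by (rule L) (use M in \<open>unfold umodule_def, blast\<close>)
  then show "lin (opKinv M) (lin (opK M) v) = v" by (simp only: lin_lin lin_bvec_id)
  have "lin (\<lambda>b. lin (opK M) (opE M b)) v = lin (\<lambda>b. scale (q ^ 2) (lin (opE M) (opK M b))) v"
    by (rule L) (use M in \<open>unfold umodule_def, blast\<close>)
  then show "lin (opK M) (lin (opE M) v) = scale (q ^ 2) (lin (opE M) (lin (opK M) v))"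
    by (simp only: lin_lin lin_fun_scale)
  have "lin (\<lambda>b. lin (opK M) (opF M b)) v = lin (\<lambda>b. scale (q powi (-2)) (lin (opF M) (opK M b))) v"
    by (rule L) (use M in \<open>unfold umodule_def, blast\<close>)
  then show "lin (opK M) (lin (opF M) v) = scale (q powi (-2)) (lin (opF M) (lin (opK M) v))"
    by (simp only: lin_lin lin_fun_scale)
  have "lin (\<lambda>b. lin (opE M) (opF M b) - lin (opF M) (opE M b)) v =
      lin (\<lambda>b. scale (1 / (q - inverse q)) (opK M b - opKinv M b)) v"
    by (rule L) (use M in \<open>unfold umodule_def, blast\<close>)
  then show "lin (opE M) (lin (opF M) v) - lin (opF M) (lin (opE M) v) =
      scale (1 / (q - inverse q)) (lin (opK M) v - lin (opKinv M) v)"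
    by (simp only: lin_lin lin_fun_scale lin_fun_diff)
qed

lemma wt_space_shift:
  assumes M: "umodule M" and v: "v \<in> wt_space M m"
  shows "lin (opE M) v \<in> wt_space M (m + 2)" "lin (opF M) v \<in> wt_space M (m - 2)"
    "lin (opK M) v \<in> wt_space M m"
  using v umodule_closed[OF M, of v] umodule_relations[OF M, of v]
  by (auto simp: wt_space_def lin_scale power_int_add power_int_diff power_int_minus field_simps)

lemma wt_indep:
  assumes "finite S" "\<And>k. k \<in> S \<Longrightarrow> f k \<in> wt_space M k" "(\<Sum>k\<in>S. f k) = 0"
  shows "\<forall>k\<in>S. f k = 0"
  using assms
proof (induction S arbitrary: f rule: finite_induct)
  case (insert a S)
  have K: "lin (opK M) (f k) = scale (q powi k) (f k)" if "k \<in> insert a S" for k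
    using insert.prems(1)[OF that] by (simp add: wt_space_def)
  have "0 = lin (opK M) (\<Sum>k\<in>insert a S. f k) - scale (q powi a) (\<Sum>k\<in>insert a S. f k)"
    by (simp only: insert.prems) simp
  also have "\<dots> = (\<Sum>k\<in>insert a S. scale (q powi k - q powi a) (f k))"
    unfolding lin_sum pm.scale_sum_right sum_subtractf[symmetric]
    by (rule sum.cong) (simp_all add: K pm.scale_left_diff_distrib)
  also have "\<dots> = (\<Sum>k\<in>S. scale (q powi k - q powi a) (f k))"
    using insert.hyps by simp
  finally have "(\<Sum>k\<in>S. scale (q powi k - q powi a) (f k)) = 0" by simp
  moreover have "scale (q powi k - q powi a) (f k) \<in> wt_space M k" if "k \<in> S" for k
    using insert.prems(1)[of k] that by (simp add: pm.subspace_scale subspace_wt_space)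
  ultimately have "\<forall>k\<in>S. scale (q powi k - q powi a) (f k) = 0"
    by (intro insert.IH) auto
  then have "\<forall>k\<in>S. f k = 0" using insert.hyps by (auto simp: q_powi_inj)
  with insert show ?case by simp
qed simp

lemma span_wt_spaces:
  assumes "x \<in> pm.span (\<Union>k\<in>A. wt_space M k)"
  obtains S f where "finite S" "S \<subseteq> A" "\<And>k. k \<in> S \<Longrightarrow> f k \<in> wt_space M k" "x = (\<Sum>k\<in>S. f k)"
proof -
  from assms have "\<exists>S f. finite S \<and> S \<subseteq> A \<and> (\<forall>k\<in>S. f k \<in> wt_space M k) \<and> x = (\<Sum>k\<in>S. f k)"
  proof (induction rule: pm.span_induct_alt)
    case base
    show ?case by (intro exI[of _ "{}"]) simp
  next
    case (step c x y)
    then obtain k S f where k: "k \<in> A" "x \<in> wt_space M k"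
      and S: "finite S" "S \<subseteq> A" "\<forall>k\<in>S. f k \<in> wt_space M k" "y = (\<Sum>k\<in>S. f k)"
      by auto
    have cx: "scale c x \<in> wt_space M k" using k by (simp add: pm.subspace_scale subspace_wt_space)
    define g where "g = (\<lambda>j. (if j \<in> S then f j else 0) + (if j = k then scale c x else 0))"
    have "(\<Sum>j\<in>insert k S. g j) = (\<Sum>j\<in>insert k S. if j \<in> S then f j else 0) + scale c x"
      using S(1) by (simp only: g_def sum.distrib) simp
    also have "(\<Sum>j\<in>insert k S. if j \<in> S then f j else 0) = y"
      using S by (simp add: sum.If_cases Int_absorb1 subset_insertI)
    finally have "scale c x + y = (\<Sum>j\<in>insert k S. g j)" by simp
    moreover have "\<forall>j\<in>insert k S. g j \<in> wt_space M j"
      using S cx subspace_wt_space[of M]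
      by (auto simp: g_def pm.subspace_0 intro!: pm.subspace_add)
    ultimately show ?case using S k by (intro exI[of _ "insert k S"] exI[of _ g]) auto
  qed
  then show ?thesis using that by blast
qed

lemma wt_space_disjoint:
  assumes "x \<in> wt_space M m" "x \<in> pm.span (\<Union>k\<in>-{m}. wt_space M k)"
  shows "x = 0"
proof -
  from assms(2) obtain S f where S: "finite S" "S \<subseteq> -{m}" "\<And>k. k \<in> S \<Longrightarrow> f k \<in> wt_space M k"
      "x = (\<Sum>k\<in>S. f k)" by (rule span_wt_spaces) blast
  have m: "m \<notin> S" using S by auto
  define g where "g = f(m := - x)"
  have "(\<Sum>k\<in>S. g k) = (\<Sum>k\<in>S. f k)" by (rule sum.cong) (use m in \<open>auto simp: g_def\<close>)
  then have "(\<Sum>k\<in>insert m S. g k) = 0" using S m by (simp add: g_def)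
  then have "\<forall>k\<in>insert m S. g k = 0"
    by (intro wt_indep[of _ g M])
      (use S assms(1) pm.subspace_neg[OF subspace_wt_space] in \<open>auto simp: g_def\<close>)
  then show ?thesis by (simp add: g_def)
qed

lemma wt_proj_eqI:
  assumes "w \<in> wt_space M m" "v - w \<in> pm.span (\<Union>k\<in>-{m}. wt_space M k)"
  shows "wt_proj M m v = w"
  unfolding wt_proj_def
proof (rule the_equality)
  fix w' assume w': "w' \<in> wt_space M m \<and> v - w' \<in> pm.span (\<Union>k\<in>-{m}. wt_space M k)"
  have "w' - w \<in> wt_space M m"
    using w' assms by (intro pm.subspace_diff subspace_wt_space) auto
  moreover have "w' - w = (v - w) - (v - w')" by simp
  then have "w' - w \<in> pm.span (\<Union>k\<in>-{m}. wt_space M k)"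
    using w' assms pm.span_diff by metis
  ultimately show "w' = w" using wt_space_disjoint by fastforce
qed (use assms in auto)

lemma wt_proj:
  assumes M: "weight_module M" and v: "v \<in> carrier M"
  shows "wt_proj M m v \<in> wt_space M m"
    "v - wt_proj M m v \<in> pm.span (\<Union>k\<in>-{m}. wt_space M k)"
proof -
  have "v \<in> pm.span (\<Union>k\<in>UNIV. wt_space M k)" using M v by (auto simp: weight_module_def)
  then obtain S f where S: "finite S" "\<And>k. k \<in> S \<Longrightarrow> f k \<in> wt_space M k" "v = (\<Sum>k\<in>S. f k)"
    by (rule span_wt_spaces) blast
  define w where "w = (if m \<in> S then f m else 0)"
  have w: "w \<in> wt_space M m" using S by (auto simp: w_def pm.subspace_0 subspace_wt_space)
  have "v - w = (\<Sum>k\<in>S - {m}. f k)" using S by (auto simp: w_def sum_diff1)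
  also have "\<dots> \<in> pm.span (\<Union>k\<in>-{m}. wt_space M k)"
    by (intro pm.span_sum pm.span_base) (use S in auto)
  finally have "v - w \<in> pm.span (\<Union>k\<in>-{m}. wt_space M k)" .
  with w wt_proj_eqI[of w M m v]
  show "wt_proj M m v \<in> wt_space M m" "v - wt_proj M m v \<in> pm.span (\<Union>k\<in>-{m}. wt_space M k)"
    by auto
qed

lemma span_lin_shift:
  assumes "\<And>k v. v \<in> wt_space M k \<Longrightarrow> lin f v \<in> wt_space M (k + d)"
    and "x \<in> pm.span (\<Union>k\<in>-{m}. wt_space M k)"
  shows "lin f x \<in> pm.span (\<Union>k\<in>-{m + d}. wt_space M k)"
  using assms(2)
proof (induction rule: pm.span_induct_alt)
  case (step c x y)
  then obtain k where "k \<noteq> m" "x \<in> wt_space M k" by auto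
  then have "lin f x \<in> (\<Union>k\<in>-{m + d}. wt_space M k)" using assms(1)[of x k] by auto
  then show ?case
    using step by (auto simp: lin_add lin_scale intro!: pm.span_add pm.span_scale intro: pm.span_base)
qed (simp add: pm.span_zero)

lemma wt_proj_shift:
  assumes M: "weight_module M" and v: "v \<in> carrier M"
    and f: "\<And>k v. v \<in> wt_space M k \<Longrightarrow> lin f v \<in> wt_space M (k + d)"
  shows "lin f (wt_proj M m v) = wt_proj M (m + d) (lin f v)"
  using wt_proj[OF M v, of m] f[of "wt_proj M m v" m] span_lin_shift[of M f d _ m, OF f]
  by (intro wt_proj_eqI[symmetric]) (auto simp flip: lin_diff)

lemma wt_proj_wt_proj:
  assumes M: "weight_module M" and v: "v \<in> carrier M"
  shows "wt_proj M m (wt_proj M n v) = (if m = n then wt_proj M m v else 0)"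
proof (cases "m = n")
  case True
  with wt_proj[OF M v, of n] show ?thesis by (auto intro!: wt_proj_eqI simp: pm.span_zero)
next
  case False
  with wt_proj(1)[OF M v, of n] show ?thesis
    by (auto intro!: wt_proj_eqI pm.span_base simp: pm.subspace_0 subspace_wt_space)
qed

lemma linear_ops_gen_op:
  assumes M: "weight_module M"
  shows "linear_ops (gen_op M) (carrier M)"
proof
  have M': "umodule M" using M by (simp add: weight_module_def)
  show "pm.subspace (carrier M)" by (rule subspace_carrier)
  have wt: "wt_proj M m v \<in> carrier M" if "v \<in> carrier M" for m v
    using wt_proj(1)[OF M that, of m] by (simp add: wt_space_def)
  show "gen_op M g v \<in> carrier M" if "v \<in> carrier M" for g v
    using that umodule_closed[OF M' that] wt by (cases g) auto
  show "gen_op M g (v + w) = gen_op M g v + gen_op M g w"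
    if vw: "v \<in> carrier M" "w \<in> carrier M" for g v w
  proof (cases g)
    case (GenIdem m)
    have "v + w - (wt_proj M m v + wt_proj M m w) = (v - wt_proj M m v) + (w - wt_proj M m w)"
      by simp
    then have "wt_proj M m (v + w) = wt_proj M m v + wt_proj M m w"
      using wt_proj[OF M vw(1), of m] wt_proj[OF M vw(2), of m]
      by (intro wt_proj_eqI) (simp_all only: pm.subspace_add subspace_wt_space pm.span_add)
    then show ?thesis by (simp add: GenIdem)
  qed (simp_all add: lin_add)
  show "gen_op M g (scale c v) = scale c (gen_op M g v)" if v: "v \<in> carrier M" for g c v
  proof (cases g)
    case (GenIdem m)
    have "wt_proj M m (scale c v) = scale c (wt_proj M m v)"
      using wt_proj[OF M v]
      by (intro wt_proj_eqI)
        (simp_all add: pm.subspace_scale subspace_wt_space pm.span_scale flip: pm.scale_right_diff_distrib)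
    then show ?thesis by (simp add: GenIdem)
  qed (simp_all add: lin_scale)
qed

lemma gen_op_relations:
  assumes M: "weight_module M" and v: "v \<in> carrier M" and r: "r \<in> urels"
  shows "free_op (gen_op M) r v = 0"
proof -
  interpret linear_ops "gen_op M" "carrier M" by (rule linear_ops_gen_op[OF M])
  have M': "umodule M" using M by (simp add: weight_module_def)
  note rel = umodule_relations[OF M' v]
  note shift = wt_space_shift[OF M']
  have wt: "lin (opK M) (wt_proj M m v) = scale (q powi m) (wt_proj M m v)" for m
    using wt_proj(1)[OF M v] by (simp add: wt_space_def)
  have wt': "wt_proj M m (lin (opK M) v) = scale (q powi m) (wt_proj M m v)" for m
    using wt_proj_shift[OF M v, of "opK M" 0 m] shift(3) wt by simp
  have EI: "lin (opE M) (wt_proj M m v) = wt_proj M (m + 2) (lin (opE M) v)" for m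
    by (rule wt_proj_shift[OF M v shift(1)])
  have FI: "lin (opF M) (wt_proj M m v) = wt_proj M (m - 2) (lin (opF M) v)" for m
    using wt_proj_shift[OF M v, of "opF M" "-2" m] shift(2) by simp
  show ?thesis
    using r by (auto simp: urels_def free_op_simps free_op_mult v mult.assoc free_op_closed
        umodule_closed[OF M'] rel wt wt' EI FI wt_proj_wt_proj[OF M v])
qed

lemma act_abs:
  assumes M: "weight_module M" and v: "v \<in> carrier M"
  shows "act M (abs_uq x) v = free_op (gen_op M) x v"
proof -
  interpret linear_ops "gen_op M" "carrier M" by (rule linear_ops_gen_op[OF M])
  have "rep_uq (abs_uq x) - x \<in> two_sided_ideal urels"
    using rep_abs_rsp_left[OF Quotient3_uq, of x x] by (simp add: two_sided_ideal.zero)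
  then have "free_op (gen_op M) (rep_uq (abs_uq x) - x) v = 0"
    by (rule ideal_annihilates[rotated, OF _ v]) (rule gen_op_relations[OF M])
  then show ?thesis by (simp add: act_def free_op_simps)
qed

lemma uq_cases: obtains x where "u = abs_uq x"
  using Quotient3_abs_rep[OF Quotient3_uq] by metis

lemma act_closed:
  assumes M: "weight_module M" and v: "v \<in> carrier M"
  shows "act M u v \<in> carrier M"
  unfolding act_def by (rule linear_ops.free_op_closed[OF linear_ops_gen_op[OF M] v])

lemma act_linear:
  assumes M: "weight_module M" and v: "v \<in> carrier M" "w \<in> carrier M"
  shows "act M u (v + w) = act M u v + act M u w" "act M u (scale c v) = scale c (act M u v)"
  unfolding act_def using linear_ops.free_op_linear[OF linear_ops_gen_op[OF M]] v by auto

lemma act_simps: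
  assumes M: "weight_module M" and v: "v \<in> carrier M"
  shows "act M (x + y) v = act M x v + act M y v"
    "act M (x * y) v = act M x (act M y v)"
    "act M (scal c) v = scale c v"
    "act M 0 v = 0" "act M 1 v = v"
    "act M uE v = lin (opE M) v"
    "act M uF v = lin (opF M) v"
    "act M uK v = lin (opK M) v"
    "act M uKinv v = lin (opKinv M) v"
    "act M (idem m) v = wt_proj M m v"
proof -
  interpret linear_ops "gen_op M" "carrier M" by (rule linear_ops_gen_op[OF M])
  obtain x' y' where xy: "x = abs_uq x'" "y = abs_uq y'" by (metis uq_cases)
  show "act M (x + y) v = act M x v + act M y v"
    by (simp add: xy plus_uq.abs_eq act_abs[OF M v] free_op_simps)
  show "act M (x * y) v = act M x (act M y v)"
    by (simp add: xy times_uq.abs_eq act_abs[OF M] v free_op_closed free_op_mult)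
qed (simp_all add: scal.abs_eq zero_uq.abs_eq one_uq.abs_eq uE.abs_eq uF.abs_eq uK.abs_eq
    uKinv.abs_eq idem.abs_eq act_abs[OF M v] free_op_simps scal_def zero_uq_def one_uq_def
    uE_def uF_def uK_def uKinv_def idem_def)


section \<open>Simple modules, twists and tensor products\<close>

text \<open>The simple module \<open>L(n)\<close>, with basis vector \<open>k\<close> standing for \<open>F\<^sup>(\<^sup>k\<^sup>) \<eta>\<^sub>n\<close>.  It is a weight
  module and simple by \<open>Lmod_weight_module\<close> and \<open>Lmod_simple\<close> below.\<close>

definition Lmod :: "nat \<Rightarrow> nat umod" where
  "Lmod n = \<lparr> basis = {..n},
     opE = (\<lambda>k. if 0 < k \<and> k \<le> n then scale (qint (n - k + 1)) (bvec (k - 1)) else 0),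
     opF = (\<lambda>k. if k < n then scale (qint (k + 1)) (bvec (k + 1)) else 0),
     opK = (\<lambda>k. scale (q powi (int n - 2 * int k)) (bvec k)),
     opKinv = (\<lambda>k. scale (q powi (2 * int k - int n)) (bvec k)) \<rparr>"

definition eta :: "nat \<Rightarrow>\<^sub>0 Qq" where "eta = bvec 0"

text \<open>The twist of a module by the involution \<open>\<omega>\<close> of \<open>U\<close> with
  \<open>E \<mapsto> F, F \<mapsto> E, K \<mapsto> K\<inverse>\<close>; it turns the highest weight vector of \<open>L(n)\<close> into
  a lowest weight vector of weight \<open>-n\<close>.\<close>

definition twist :: "'b umod \<Rightarrow> 'b umod" where
  "twist M = \<lparr> basis = basis M, opE = opF M, opF = opE M, opK = opKinv M, opKinv = opK M \<rparr>"

definition Lmod_omega :: "nat \<Rightarrow> nat umod" where "Lmod_omega n = twist (Lmod n)"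

definition xi :: "nat \<Rightarrow>\<^sub>0 Qq" where "xi = bvec 0"

text \<open>The action through the comultiplication \<open>\<Delta>(E) = E \<otimes> 1 + K \<otimes> E\<close>,
  \<open>\<Delta>(F) = F \<otimes> K\<inverse> + 1 \<otimes> F\<close>, \<open>\<Delta>(K) = K \<otimes> K\<close>.\<close>

definition tensor :: "'b umod \<Rightarrow> 'c umod \<Rightarrow> ('b \<times> 'c) umod" where
  "tensor M N = \<lparr> basis = basis M \<times> basis N,
     opE = (\<lambda>(b, c). tens (opE M b) (bvec c) + tens (opK M b) (opE N c)),
     opF = (\<lambda>(b, c). tens (opF M b) (opKinv N c) + tens (bvec b) (opF N c)),
     opK = (\<lambda>(b, c). tens (opK M b) (opK N c)),
     opKinv = (\<lambda>(b, c). tens (opKinv M b) (opKinv N c)) \<rparr>"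

lemma qint_identity:
  assumes "k \<le> n"
  shows "qint (k + 1) * qint (n - k) - qint (n - k + 1) * qint k =
    1 / (q - inverse q) * (q powi (int n - 2 * int k) - q powi (2 * int k - int n))"
proof -
  define A B where "A = q powi int k" and "B = q powi int (n - k)"
  have AB: "A \<noteq> 0" "B \<noteq> 0" by (simp_all add: A_def B_def)
  define d where "d = q - inverse q"
  have d: "d \<noteq> 0" by (simp add: d_def)
  have 1: "q powi (int n - 2 * int k) = B / A" "q powi (2 * int k - int n) = A / B"
    using power_int_diff[of q "int (n - k)" "int k"] power_int_diff[of q "int k" "int (n - k)"] assms
    by (simp_all add: A_def B_def of_nat_diff algebra_simps)
  have 2: "qint k = (A - 1 / A) / d" "qint (n - k) = (B - 1 / B) / d"
    "qint (k + 1) = (A * q - 1 / (A * q)) / d" "qint (n - k + 1) = (B * q - 1 / (B * q)) / d"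
    by (simp_all add: qint_def d_def A_def B_def power_int_minus power_int_add power_int_diff
        inverse_eq_divide mult.commute)
  have "(A * q - 1 / (A * q)) * (B - 1 / B) - (B * q - 1 / (B * q)) * (A - 1 / A)
      = (q - inverse q) * (B / A - A / B)"
    using AB by (simp add: field_simps)
  then have "((A * q - 1 / (A * q)) / d) * ((B - 1 / B) / d) - ((B * q - 1 / (B * q)) / d) * ((A - 1 / A) / d)
      = d * (B / A - A / B) / (d * d)"
    by (simp add: d_def flip: diff_divide_distrib)
  then show ?thesis unfolding 1 2 using d by (simp add: d_def)
qed

lemma Lmod_weight_module: "weight_module (Lmod n)"
  unfolding weight_module_def
proof
  have K: "scale (qint (n - Suc k)) (bvec k) = 0" if "n = Suc k" for k :: nat
    using that by (simp add: qint_def)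
  show "umodule (Lmod n)"
    unfolding umodule_def
  proof (intro ballI conjI)
    fix k assume "k \<in> basis (Lmod n)"
    then have k: "k \<le> n" by (simp add: Lmod_def)
    show "opE (Lmod n) k \<in> carrier (Lmod n)" "opF (Lmod n) k \<in> carrier (Lmod n)"
      "opK (Lmod n) k \<in> carrier (Lmod n)" "opKinv (Lmod n) k \<in> carrier (Lmod n)"
      using k by (auto simp: Lmod_def intro!: pm.subspace_scale pm.subspace_0 subspace_carrier)
        (auto simp: carrier_def bvec_def)
    show "lin (opK (Lmod n)) (opKinv (Lmod n) k) = bvec k"
      "lin (opKinv (Lmod n)) (opK (Lmod n) k) = bvec k"
      by (simp_all add: Lmod_def lin_scale flip: power_int_add)
    show "lin (opK (Lmod n)) (opE (Lmod n) k) =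
        scale (q\<^sup>2) (lin (opE (Lmod n)) (opK (Lmod n) k))"
      using k by (auto simp: Lmod_def lin_scale of_nat_diff algebra_simps power_int_add power_int_diff
          power2_eq_square power_int_minus)
    show "lin (opK (Lmod n)) (opF (Lmod n) k) =
        scale (q powi - 2) (lin (opF (Lmod n)) (opK (Lmod n) k))"
      by (auto simp: Lmod_def lin_scale algebra_simps power_int_add power_int_diff power_int_minus
          divide_inverse)
    have "lin (opE (Lmod n)) (opF (Lmod n) k) = scale (qint (k + 1) * qint (n - k)) (bvec k)"
      using k by (auto simp: Lmod_def lin_scale qint_def Suc_diff_Suc)
    moreover have "lin (opF (Lmod n)) (opE (Lmod n) k) = scale (qint (n - k + 1) * qint k) (bvec k)"
      using k by (auto simp: Lmod_def lin_scale qint_def)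
    ultimately show "lin (opE (Lmod n)) (opF (Lmod n) k) - lin (opF (Lmod n)) (opE (Lmod n) k) =
        scale (1 / (q - inverse q)) (opK (Lmod n) k - opKinv (Lmod n) k)"
      using qint_identity[OF k] by (simp add: Lmod_def flip: pm.scale_left_diff_distrib)
  qed
  show "carrier (Lmod n) \<subseteq> pm.span (\<Union>m. wt_space (Lmod n) m)"
  proof
    fix v assume v: "v \<in> carrier (Lmod n)"
    have "bvec k \<in> wt_space (Lmod n) (int n - 2 * int k)" if "k \<in> keys v" for k
      using that v bvec_carrier[of k "Lmod n"] by (auto simp: wt_space_def Lmod_def carrier_def)
    then have "lin bvec v \<in> pm.span (\<Union>m. wt_space (Lmod n) m)"
      unfolding lin_def by (intro pm.span_sum pm.span_scale pm.span_base) auto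
    then show "v \<in> pm.span (\<Union>m. wt_space (Lmod n) m)" by simp
  qed
qed

lemma twist_simps [simp]:
  "basis (twist M) = basis M" "carrier (twist M) = carrier M"
  "opE (twist M) = opF M" "opF (twist M) = opE M" "opK (twist M) = opKinv M" "opKinv (twist M) = opK M"
  by (simp_all add: twist_def carrier_def)

lemma twist_weight_module:
  assumes M: "weight_module M"
  shows "weight_module (twist M)"
  unfolding weight_module_def
proof
  have M': "umodule M" using M by (simp add: weight_module_def)
  note closed = umodule_closed[OF M']
  note rel = umodule_relations[OF M']
  have cancel: "v = w" if "lin (opK M) v = lin (opK M) w" "v \<in> carrier M" "w \<in> carrier M" for v w
    using rel(2) that by metis
  show "umodule (twist M)"
    unfolding umodule_def
  proof (intro ballI conjI)
    fix b assume "b \<in> basis (twist M)"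
    then have b: "bvec b \<in> carrier M" by (simp add: bvec_carrier)
    note c = closed[OF b, simplified]
    show "opE (twist M) b \<in> carrier (twist M)" "opF (twist M) b \<in> carrier (twist M)"
      "opK (twist M) b \<in> carrier (twist M)" "opKinv (twist M) b \<in> carrier (twist M)"
      using c by auto
    show "lin (opK (twist M)) (opKinv (twist M) b) = bvec b"
      "lin (opKinv (twist M)) (opK (twist M) b) = bvec b"
      using rel(1,2)[OF b] by simp_all
    have "lin (opKinv M) (opF M b) = scale (q\<^sup>2) (lin (opF M) (opKinv M b))"
      by (rule cancel)
        (use rel(1)[OF c(2)] rel(4)[OF c(4)] rel(1)[OF b] closed c in
          \<open>auto simp: lin_scale power_int_minus intro!: pm.subspace_scale subspace_carrier\<close>)
    then show "lin (opK (twist M)) (opE (twist M) b) =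
        scale (q\<^sup>2) (lin (opE (twist M)) (opK (twist M) b))" by simp
    have "lin (opKinv M) (opE M b) = scale (q powi -2) (lin (opE M) (opKinv M b))"
      by (rule cancel)
        (use rel(1)[OF c(1)] rel(3)[OF c(4)] rel(1)[OF b] closed c in
          \<open>auto simp: lin_scale power_int_minus intro!: pm.subspace_scale subspace_carrier\<close>)
    then show "lin (opK (twist M)) (opF (twist M) b) =
        scale (q powi - 2) (lin (opF (twist M)) (opK (twist M) b))" by simp
    have "- (lin (opE M) (opF M b) - lin (opF M) (opE M b)) =
        scale (1 / (q - inverse q)) (- (opK M b - opKinv M b))"
      using rel(5)[OF b] by (simp only: lin_bvec pm.scale_minus_right)
    then show "lin (opE (twist M)) (opF (twist M) b) - lin (opF (twist M)) (opE (twist M) b) =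
        scale (1 / (q - inverse q)) (opK (twist M) b - opKinv (twist M) b)"
      by (simp only: minus_diff_eq twist_simps)
  qed
  have "wt_space M m \<subseteq> wt_space (twist M) (- m)" for m
  proof
    fix v assume v: "v \<in> wt_space M m"
    then have "lin (opKinv M) (scale (q powi m) v) = v"
      using rel(2)[of v] by (simp add: wt_space_def)
    then have "scale (q powi (- m)) (scale (q powi m) (lin (opKinv M) v)) = scale (q powi (- m)) v"
      by (simp add: lin_scale)
    with v show "v \<in> wt_space (twist M) (- m)"
      by (simp add: wt_space_def power_int_minus)
  qed
  then have "(\<Union>m. wt_space M m) \<subseteq> (\<Union>m. wt_space (twist M) m)" by blast
  then have "pm.span (\<Union>m. wt_space M m) \<subseteq> pm.span (\<Union>m. wt_space (twist M) m)"
    by (rule pm.span_mono)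
  then show "carrier (twist M) \<subseteq> pm.span (\<Union>m. wt_space (twist M) m)"
    using M by (auto simp: weight_module_def)
qed

lemma tens_carrier: "x \<in> carrier M \<Longrightarrow> y \<in> carrier N \<Longrightarrow> tens x y \<in> carrier (tensor M N)"
  by (auto simp: carrier_def tensor_def in_keys_iff)

lemma tensor_ops:
  "lin (opE (tensor M N)) (tens x y) = tens (lin (opE M) x) y + tens (lin (opK M) x) (lin (opE N) y)"
  "lin (opF (tensor M N)) (tens x y) = tens (lin (opF M) x) (lin (opKinv N) y) + tens x (lin (opF N) y)"
  "lin (opK (tensor M N)) (tens x y) = tens (lin (opK M) x) (lin (opK N) y)"
  "lin (opKinv (tensor M N)) (tens x y) = tens (lin (opKinv M) x) (lin (opKinv N) y)"
  using tens_lin[of "opE M" x bvec y] tens_lin[of "opK M" x "opE N" y]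
    tens_lin[of "opF M" x "opKinv N" y] tens_lin[of bvec x "opF N" y]
    tens_lin[of "opK M" x "opK N" y] tens_lin[of "opKinv M" x "opKinv N" y]
  by (simp_all add: tensor_def case_prod_unfold lin_fun_add)

lemma tensor_weight_module:
  assumes M: "weight_module M" and N: "weight_module N"
  shows "weight_module (tensor M N)"
  unfolding weight_module_def
proof
  have M': "umodule M" and N': "umodule N" using M N by (simp_all add: weight_module_def)
  note closed = umodule_closed[OF M'] umodule_closed[OF N']
  note rel = umodule_relations[OF M'] umodule_relations[OF N']
  show "umodule (tensor M N)"
    unfolding umodule_def
  proof
    fix bc assume "bc \<in> basis (tensor M N)"
    then obtain b c where bc: "bc = (b, c)" "b \<in> basis M" "c \<in> basis N" by (auto simp: tensor_def)
    define x y where "x = (bvec b :: 'a \<Rightarrow>\<^sub>0 Qq)" and "y = (bvec c :: 'b \<Rightarrow>\<^sub>0 Qq)"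
    have x: "x \<in> carrier M" and y: "y \<in> carrier N" using bc by (simp_all add: x_def y_def bvec_carrier)
    let ?T = "tensor M N"
    let ?d = "1 / (q - inverse q)"
    have op: "f bc = lin f (tens x y)" for f :: "'a \<times> 'b \<Rightarrow> ('a \<times> 'b \<Rightarrow>\<^sub>0 Qq)"
      by (simp add: bc x_def y_def)
    have bv: "bvec bc = tens x y" by (simp add: bc x_def y_def)
    have cx: "lin (opE M) x \<in> carrier M" "lin (opF M) x \<in> carrier M" "lin (opK M) x \<in> carrier M"
      "lin (opKinv M) x \<in> carrier M" using closed x by auto
    have cy: "lin (opE N) y \<in> carrier N" "lin (opF N) y \<in> carrier N" "lin (opK N) y \<in> carrier N"
      "lin (opKinv N) y \<in> carrier N" using closed y by auto
    have KF: "lin (opF M) (lin (opK M) x) = scale (q ^ 2) (lin (opK M) (lin (opF M) x))"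
      using rel(4)[OF x] by (simp add: power_int_minus)
    have KinvE: "lin (opKinv N) (lin (opE N) y) = scale (q powi -2) (lin (opE N) (lin (opKinv N) y))"
    proof -
      have "lin (opKinv N) (lin (opK N) (lin (opE N) (lin (opKinv N) y)))
          = lin (opE N) (lin (opKinv N) y)"
        using rel(7) closed cy by auto
      then have "scale (q ^ 2) (lin (opKinv N) (lin (opE N) y)) = lin (opE N) (lin (opKinv N) y)"
        using rel(8)[OF cy(4)] rel(6)[OF y] by (simp add: lin_scale)
      then have "scale (q powi -2) (scale (q ^ 2) (lin (opKinv N) (lin (opE N) y))) =
          scale (q powi -2) (lin (opE N) (lin (opKinv N) y))" by simp
      then show ?thesis by (simp add: power_int_minus)
    qed
    have "lin (opE ?T) (lin (opF ?T) (tens x y)) - lin (opF ?T) (lin (opE ?T) (tens x y)) =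
      tens (lin (opE M) (lin (opF M) x) - lin (opF M) (lin (opE M) x)) (lin (opKinv N) y) +
      tens (lin (opK M) x) (lin (opE N) (lin (opF N) y) - lin (opF N) (lin (opE N) y))"
      by (simp add: tensor_ops lin_add tens_simps KF KinvE power_int_minus)
    also have "\<dots> = scale ?d (tens (lin (opK M) x) (lin (opK N) y) - tens (lin (opKinv M) x) (lin (opKinv N) y))"
      unfolding rel(5)[OF x] rel(10)[OF y] by (simp add: tens_simps flip: pm.scale_right_distrib)
    finally have EF: "lin (opE ?T) (lin (opF ?T) (tens x y)) - lin (opF ?T) (lin (opE ?T) (tens x y)) =
      scale ?d (tens (lin (opK M) x) (lin (opK N) y) - tens (lin (opKinv M) x) (lin (opKinv N) y))" .
    show "opE ?T bc \<in> carrier ?T \<and> opF ?T bc \<in> carrier ?T \<and> opK ?T bc \<in> carrier ?T \<and>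
         opKinv ?T bc \<in> carrier ?T \<and>
         lin (opK ?T) (opKinv ?T bc) = bvec bc \<and>
         lin (opKinv ?T) (opK ?T bc) = bvec bc \<and>
         lin (opK ?T) (opE ?T bc) = scale (q\<^sup>2) (lin (opE ?T) (opK ?T bc)) \<and>
         lin (opK ?T) (opF ?T bc) = scale (q powi - 2) (lin (opF ?T) (opK ?T bc)) \<and>
         lin (opE ?T) (opF ?T bc) - lin (opF ?T) (opE ?T bc) =
         scale (1 / (q - inverse q)) (opK ?T bc - opKinv ?T bc)"
      unfolding op bv
      using EF x y cx cy
      by (intro conjI)
        (auto simp: tensor_ops lin_add tens_simps pm.scale_right_distrib
          rel(1-4)[OF x] rel(6-9)[OF y]
          intro!: pm.subspace_add subspace_carrier tens_carrier)
  qed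
  let ?S = "pm.span (\<Union>m. wt_space (tensor M N) m)"
  have 1: "tens x y \<in> ?S" if "x \<in> wt_space M i" "y \<in> wt_space N j" for x y i j
  proof -
    have "tens x y \<in> wt_space (tensor M N) (i + j)"
      using that by (auto simp: wt_space_def tens_carrier tensor_ops tens_simps power_int_add mult.commute)
    then show ?thesis by (intro pm.span_base) auto
  qed
  have 2: "tens x y \<in> ?S" if "x \<in> pm.span (\<Union>m. wt_space M m)" "y \<in> wt_space N j" for x y j
    using that(1)
    by (induction rule: pm.span_induct_alt)
      (auto simp: tens_simps pm.span_zero intro!: pm.span_add pm.span_scale 1[OF _ that(2)])
  have 3: "tens x y \<in> ?S" if "y \<in> pm.span (\<Union>m. wt_space N m)" "x \<in> carrier M" for x y
    using that(1)
    by (induction rule: pm.span_induct_alt)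
      (use M that(2) in \<open>auto simp: tens_simps pm.span_zero weight_module_def intro!: pm.span_add pm.span_scale 2\<close>)
  show "carrier (tensor M N) \<subseteq> ?S"
  proof
    fix v assume v: "v \<in> carrier (tensor M N)"
    have "bvec bc \<in> ?S" if "bc \<in> keys v" for bc
    proof -
      have "bc \<in> basis M \<times> basis N" using that v by (auto simp: carrier_def tensor_def)
      then obtain b c where bc: "bc = (b, c)" "b \<in> basis M" "c \<in> basis N" by blast
      then have "tens (bvec b) (bvec c) \<in> ?S"
        using N by (intro 3) (auto simp: weight_module_def bvec_carrier)
      with bc show ?thesis by simp
    qed
    then have "lin bvec v \<in> ?S" unfolding lin_def by (intro pm.span_sum pm.span_scale)
    then show "v \<in> ?S" by simp
  qed
qed

definition submodule :: "'b umod \<Rightarrow> ('b \<Rightarrow>\<^sub>0 Qq) set \<Rightarrow> bool" where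
  "submodule M S \<longleftrightarrow> pm.subspace S \<and> S \<subseteq> carrier M \<and>
    (\<forall>v\<in>S. lin (opE M) v \<in> S \<and> lin (opF M) v \<in> S \<and> lin (opK M) v \<in> S \<and> lin (opKinv M) v \<in> S)"

definition simple_module :: "'b umod \<Rightarrow> bool" where
  "simple_module M \<longleftrightarrow> carrier M \<noteq> {0} \<and> (\<forall>S. submodule M S \<longrightarrow> S = {0} \<or> S = carrier M)"

lemma submodule_twist: "submodule (twist M) S \<longleftrightarrow> submodule M S"
  by (auto simp: submodule_def)

lemma Lmod_simple: "simple_module (Lmod n)"
  unfolding simple_module_def
proof (intro conjI allI impI)
  show "carrier (Lmod n) \<noteq> {0}"
    using bvec_carrier[of 0 "Lmod n"] by (auto simp: Lmod_def bvec_def)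
  fix S
  assume "submodule (Lmod n) S"
  then have S: "pm.subspace S" "S \<subseteq> carrier (Lmod n)"
    and E: "\<And>v. v \<in> S \<Longrightarrow> lin (opE (Lmod n)) v \<in> S"
    and F: "\<And>v. v \<in> S \<Longrightarrow> lin (opF (Lmod n)) v \<in> S" by (auto simp: submodule_def)
  show "S = {0} \<or> S = carrier (Lmod n)"
  proof (cases "S \<subseteq> {0}")
    case True
    then show ?thesis using pm.subspace_0[OF S(1)] by auto
  next
    case False
    then obtain v where "v \<in> S" "v \<noteq> 0" by auto
    then have "\<exists>j v. v \<in> S \<and> lookup v j \<noteq> 0 \<and> keys v \<subseteq> {..j}"
      by (intro exI[of _ "Max (keys v)"] exI[of _ v]) (auto simp flip: in_keys_iff)
    then have 0: "bvec 0 \<in> S"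
    proof (elim exE)
      fix j v assume "v \<in> S \<and> lookup v j \<noteq> 0 \<and> keys v \<subseteq> {..j}"
      then show "bvec 0 \<in> S"
      proof (induction j arbitrary: v)
        case 0
        then have "v = scale (lookup v 0) (bvec 0)"
          by (intro poly_mapping_eqI) (auto simp: bvec_def lookup_single lookup_one when_def in_keys_iff subset_iff)
        then have "scale (inverse (lookup v 0)) v = bvec 0"
          using 0 by (metis pm.scale_scale pm.scale_one left_inverse)
        then show ?case using 0 pm.subspace_scale[OF S(1)] by metis
      next
        case (Suc j)
        have jn: "Suc j \<le> n" using Suc.prems S(2) by (auto simp: carrier_def Lmod_def in_keys_iff subset_iff)
        let ?w = "lin (opE (Lmod n)) v"
        have w: "lookup ?w i = (if i < n then lookup v (Suc i) * qint (n - i) else 0)" for i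
        proof -
          have "lookup ?w i = (\<Sum>k\<in>keys v. if k = Suc i \<and> i < n then lookup v k * qint (n - i) else 0)"
            unfolding lin_def lookup_sum
            by (rule sum.cong) (auto simp: Lmod_def bvec_def lookup_single when_def Suc_diff_Suc)
          then show ?thesis by (auto simp: in_keys_iff)
        qed
        have "lookup ?w j \<noteq> 0" using Suc.prems jn by (simp add: w qint_nonzero)
        moreover have "keys ?w \<subseteq> {..j}" using Suc.prems by (auto simp: in_keys_iff w subset_iff split: if_splits)
        ultimately show ?case using Suc.IH[of ?w] E Suc.prems by blast
      qed
    qed
    have b: "bvec k \<in> S" if "k \<le> n" for k
      using that
    proof (induction k)
      case (Suc k)
      then have "scale (inverse (qint (Suc k))) (lin (opF (Lmod n)) (bvec k)) \<in> S"
        by (intro pm.subspace_scale S F) auto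
      then show ?case using Suc.prems qint_nonzero[of "Suc k"] by (simp add: Lmod_def)
    qed (use 0 in simp)
    have "v \<in> S" if "v \<in> carrier (Lmod n)" for v
    proof -
      have "lin bvec v \<in> S"
        unfolding lin_def
        by (intro pm.subspace_sum pm.subspace_scale S b) (use that in \<open>auto simp: carrier_def Lmod_def\<close>)
      then show ?thesis by simp
    qed
    with S show ?thesis by auto
  qed
qed

lemma Lmod_omega_weight_module: "weight_module (Lmod_omega n)"
  by (simp add: Lmod_omega_def twist_weight_module Lmod_weight_module)

lemma Lmod_omega_simple: "simple_module (Lmod_omega n)"
  using Lmod_simple[of n] by (simp add: Lmod_omega_def simple_module_def submodule_twist)


section \<open>Asymptotics and the elements \<open>w\<^sub>m(a, b)\<close>\<close>

definition TL :: "int \<Rightarrow> nat \<Rightarrow> (nat \<times> nat) umod" where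
  "TL m p = tensor (Lmod_omega p) (Lmod (nat (int p + m)))"

lemma TL_weight_module: "weight_module (TL m p)"
  by (simp add: TL_def tensor_weight_module Lmod_omega_weight_module Lmod_weight_module)

text \<open>Coefficients that are finite sums of the terms \<open>f\<^sub>s(q) q\<^sup>-\<^sup>2\<^sup>s\<^sup>p\<close> with \<open>s \<ge> 1\<close>.\<close>

definition small_coeff :: "(nat \<Rightarrow> Qq) \<Rightarrow> bool" where
  "small_coeff c \<longleftrightarrow>
     (\<exists>S f. finite S \<and> S \<subseteq> {1..} \<and> (\<forall>p. c p = (\<Sum>s\<in>S. f s * q powi (- (2 * int s * int p)))))"

definition asymp_zero :: "int \<Rightarrow> (nat \<Rightarrow> (nat \<times> nat \<Rightarrow>\<^sub>0 Qq)) \<Rightarrow> bool" where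
  "asymp_zero m z \<longleftrightarrow>
     (\<exists>A B f g. finite A \<and> A \<subseteq> Udot \<and> finite B \<and> B \<subseteq> Uplus \<times> Uminus \<and>
       (\<forall>u\<in>A. small_coeff (f u)) \<and> (\<forall>w\<in>B. small_coeff (g w)) \<and>
       (\<forall>p. int p + m \<ge> 0 \<longrightarrow>
          z p = (\<Sum>u\<in>A. scale (f u p) (act (TL m p) (u * idem m) (tens xi eta)))
              + (\<Sum>(x, y)\<in>B. scale (g (x, y) p)
                   (tens (act (Lmod_omega p) x xi) (act (Lmod (nat (int p + m))) y eta)))))"

text \<open>The unique element of \<open>Udot 1\<^sub>m\<close> with the stated asymptotics.  The description operator is
  used, so any fact about \<open>ww m a b\<close> rests on a proof of existence and uniqueness.\<close>

definition ww :: "int \<Rightarrow> nat \<Rightarrow> nat \<Rightarrow> uq" where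
  "ww m a b = (THE w. w \<in> Udot_idem m \<and>
     asymp_zero m (\<lambda>p. act (TL m p) w (tens xi eta)
       - tens (act (Lmod_omega p) (divE a) xi) (act (Lmod (nat (int p + m))) (divF b) eta)))"

end

theory Submission
  imports Defs
 begin

text \<open>
  Write \<open>v\<^sub>i\<^sub>j = E\<^sup>(\<^sup>i\<^sup>) \<xi> \<otimes> F\<^sup>(\<^sup>j\<^sup>) \<eta>\<close> in the \<open>p\<close>-th tensor product (\<^const>\<open>Defs.TL\<close>).  In the
  basis of the \<open>v\<^sub>i\<^sub>j\<close> the matrix entries of \<open>E\<close> and \<open>F\<close> are polynomials in \<open>t = q\<^sup>-\<^sup>2\<^sup>p\<close> with coefficients
  that do not involve \<open>p\<close>, and a sequence is asymptotically zero exactly when all its coordinates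
  are polynomials in \<open>t\<close> that vanish at \<open>t = 0\<close>.  So asymptotics amount to setting \<open>t = 0\<close>, and this
  limit is well defined because a polynomial with the infinitely many roots \<open>q\<^sup>-\<^sup>2\<^sup>p\<close> is zero
  (\<open>tends_unique\<close>).  The limit of an element \<open>u\<close> of the algebra
  is that of the sequence \<open>u (\<xi> \<otimes> \<eta>)\<close>.  At \<open>t = 0\<close> the operators become
  \<open>E v\<^sub>i\<^sub>j = [i+1] v\<^sub>i\<^sub>+\<^sub>1\<^sub>,\<^sub>j + q\<^sup>2\<^sup>i\<^sup>-\<^sup>j\<^sup>+\<^sup>1\<^sup>+\<^sup>m / (q - q\<^sup>-\<^sup>1) v\<^sub>i\<^sub>,\<^sub>j\<^sub>-\<^sub>1\<close> and the mirror image of this for \<open>F\<close>, with \<open>i\<close> and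
  \<open>j\<close> exchanged and \<open>m\<close> replaced by \<open>-m\<close>.

  Both summands of the limit of \<open>E\<close> shift the indices and they commute up to \<open>q\<^sup>2\<close>, so the divided
  powers of \<open>E\<close> are given by a \<open>q\<close>-binomial formula, which is \<open>lin_straight_sum\<close>.  Applied to
  \<open>v\<^sub>0\<^sub>b\<close>, the limit of \<open>F\<^sup>(\<^sup>b\<^sup>) v\<^sub>0\<^sub>0\<close>, it says that the limit of \<open>E\<^sup>(\<^sup>a\<^sup>) F\<^sup>(\<^sup>b\<^sup>) 1\<^sub>m\<close> is the
  combination of the \<open>v\<^sub>a\<^sub>-\<^sub>s\<^sub>,\<^sub>b\<^sub>-\<^sub>s\<close> with the coefficients of the first formula; its mirror image gives
  the second formula in the same sense.  It remains to pass from limits back to the algebra.  The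
  coefficient of \<open>v\<^sub>a\<^sub>b\<close> is \<open>1\<close>, so the triangular system can be inverted, which produces elements with
  limit exactly \<open>v\<^sub>a\<^sub>b\<close> (\<open>basis_lift\<close>).  Since the monomials \<open>E\<^sup>a F\<^sup>b 1\<^sub>m\<close> span \<open>U 1\<^sub>m\<close>
  (\<open>mult_idem_in_span_pbw\<close>), so do these elements, and therefore an element is determined by its limit
  (\<open>limit_determines_element\<close>).  This gives existence and uniqueness of \<^const>\<open>Defs.ww\<close> at once
  (\<open>ww_eq_basis_lift\<close>), and an identity between limits is an identity in the algebra.
\<close>

section \<open>Spanning sets of the quantum group\<close>

global_interpretation uq: vector_space "\<lambda>c x. scal c * x"
  by unfold_locales (simp_all add: scal_simps algebra_simps)

lemma scal_left_commute: "x * (scal c * y) = scal c * (x * y)"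
  by (metis mult.assoc scal_commute)

lemma mult_span_left:
  assumes "\<And>s. s \<in> B \<Longrightarrow> g * s \<in> uq.span C" "x \<in> uq.span B"
  shows "g * x \<in> uq.span C"
  using assms(2)
  by (induction rule: uq.span_induct_alt)
    (auto simp: uq.span_zero distrib_left scal_left_commute
      intro!: uq.span_add uq.span_scale assms(1))

lemma subalgebra_subset_span_powers: "subalgebra {x} \<subseteq> uq.span (range (\<lambda>k. x ^ k))"
proof
  fix y assume "y \<in> subalgebra {x}"
  then show "y \<in> uq.span (range (\<lambda>k. x ^ k))"
  proof induction
    case (scal c)
    have "scal c * x ^ 0 \<in> uq.span (range (\<lambda>k. x ^ k))"
      by (intro uq.span_scale uq.span_base rangeI)
    then show ?case by simp
  next
    case (gen y)
    have "x ^ 1 \<in> uq.span (range (\<lambda>k. x ^ k))" by (intro uq.span_base rangeI)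
    then show ?case using gen by simp
  next
    case (mult y z)
    have pow: "x ^ k * z \<in> uq.span (range (\<lambda>k. x ^ k))" for k
      using mult.IH(2)
    proof (rule mult_span_left[rotated])
      fix s assume "s \<in> range (\<lambda>k. x ^ k)"
      then show "x ^ k * s \<in> uq.span (range (\<lambda>k. x ^ k))"
        by (auto simp flip: power_add intro: uq.span_base)
    qed
    show ?case using mult.IH(1)
      by (induction rule: uq.span_induct_alt)
        (use pow in \<open>auto simp: uq.span_zero distrib_right mult.assoc intro!: uq.span_add uq.span_scale\<close>)
  qed (auto intro: uq.span_add)
qed

lemma uE_power_idem: "uE ^ a * idem k = idem (k + 2 * int a) * uE ^ a"
proof (induction a)
  case (Suc a)
  have "uE ^ Suc a * idem k = uE * idem (k + 2 * int a) * uE ^ a"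
    by (simp add: Suc mult.assoc)
  then show ?case by (simp add: uq_relations(9) mult.assoc algebra_simps)
qed simp

lemma uF_power_idem: "uF ^ b * idem k = idem (k - 2 * int b) * uF ^ b"
proof (induction b)
  case (Suc b)
  have "uF ^ Suc b * idem k = uF * idem (k - 2 * int b) * uF ^ b"
    by (simp add: Suc mult.assoc)
  then show ?case by (simp add: uq_relations(10) mult.assoc algebra_simps)
qed simp

lemma uKinv_idem: "uKinv * idem k = scal (q powi (- k)) * idem k"
proof -
  have "uKinv * idem k = scal (q powi (- k)) * (uKinv * (scal (q powi k) * idem k))"
    by (simp add: scal_left_commute[of uKinv] power_int_minus)
  also have "scal (q powi k) * idem k = uK * idem k" by (simp add: uq_relations(7))
  also have "uKinv * (uK * idem k) = idem k" by (simp add: uq_relations(2) flip: mult.assoc)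
  finally show ?thesis .
qed

definition pbw :: "int \<Rightarrow> nat \<Rightarrow> nat \<Rightarrow> uq" where
  "pbw m a b = uE ^ a * uF ^ b * idem m"

lemma pbw_idem: "pbw m a b = idem (m - 2 * int b + 2 * int a) * pbw m a b"
proof -
  have "pbw m a b = uE ^ a * idem (m - 2 * int b) * uF ^ b"
    by (simp add: pbw_def mult.assoc uF_power_idem)
  then have *: "pbw m a b = idem (m - 2 * int b + 2 * int a) * (uE ^ a * uF ^ b)"
    by (simp add: uE_power_idem mult.assoc)
  show ?thesis by (subst (1 2) *) (simp add: uq_relations(6) flip: mult.assoc)
qed

lemma pbw_in_span: "pbw m a b \<in> uq.span (range (\<lambda>(a, b). pbw m a b))"
  by (auto intro!: uq.span_base)

text \<open>
  Only \<open>F\<close> needs work: by induction on \<open>a\<close>, the commutator moves \<open>F\<close> past one factor \<open>E\<close>, and the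
  correction is a scalar multiple of a monomial because \<open>K\<close> acts on \<open>E\<^sup>a F\<^sup>b 1\<^sub>m\<close> by a power of \<open>q\<close>.
\<close>

lemma uF_mult_pbw_in_span: "uF * pbw m a b \<in> uq.span (range (\<lambda>(a, b). pbw m a b))"
proof (induction a)
  case 0
  have "uF * pbw m 0 b = pbw m 0 (Suc b)" by (simp add: pbw_def mult.assoc)
  then show ?case by (simp add: pbw_in_span)
next
  case (Suc a)
  define k where "k = m - 2 * int b + 2 * int a"
  define d where "d = 1 / (q - inverse q)"
  have "uF * uE = uE * uF - scal d * (uK - uKinv)"
    using uq_relations(5) by (simp add: d_def algebra_simps)
  then have "uF * pbw m (Suc a) b = (uE * uF - scal d * (uK - uKinv)) * pbw m a b"
    by (simp add: pbw_def flip: mult.assoc)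
  also have "\<dots> = uE * (uF * pbw m a b) - scal d * ((uK - uKinv) * pbw m a b)"
    by (simp add: algebra_simps)
  also have "(uK - uKinv) * pbw m a b = (uK * idem k - uKinv * idem k) * pbw m a b"
    by (subst pbw_idem) (simp add: k_def algebra_simps)
  also have "\<dots> = scal (q powi k - q powi (- k)) * (idem k * pbw m a b)"
    by (simp add: uq_relations(7) uKinv_idem uq.scale_left_diff_distrib mult.assoc left_diff_distrib)
  also have "idem k * pbw m a b = pbw m a b" unfolding k_def by (rule pbw_idem[symmetric])
  finally have eq: "uF * pbw m (Suc a) b = uE * (uF * pbw m a b) -
    scal d * (scal (q powi k - q powi (- k)) * pbw m a b)" .
  have "uE * (uF * pbw m a b) \<in> uq.span (range (\<lambda>(a, b). pbw m a b))"
    using Suc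
  proof (rule mult_span_left[rotated])
    fix s assume "s \<in> range (\<lambda>(a, b). pbw m a b)"
    then obtain a b where "s = pbw m a b" by auto
    then have "uE * s = pbw m (Suc a) b" by (simp add: pbw_def mult.assoc)
    then show "uE * s \<in> uq.span (range (\<lambda>(a, b). pbw m a b))" by (simp add: pbw_in_span)
  qed
  then show ?case unfolding eq
    by (intro uq.span_diff uq.span_scale pbw_in_span)
qed

lemma generator_mult_pbw_in_span:
  "abs_uq (fg g) * pbw m a b \<in> uq.span (range (\<lambda>(a, b). pbw m a b))"
proof -
  define k where "k = m - 2 * int b + 2 * int a"
  have k: "pbw m a b = idem k * pbw m a b" unfolding k_def by (rule pbw_idem)
  have scalar: "x * pbw m a b \<in> uq.span (range (\<lambda>(a, b). pbw m a b))"
    if "x * idem k = scal c * idem k" for x c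
  proof -
    have "x * pbw m a b = scal c * pbw m a b"
      by (subst (1 2) k) (simp add: that flip: mult.assoc)
    then show ?thesis using pbw_in_span by (simp add: uq.span_scale)
  qed
  show ?thesis
  proof (cases g)
    case GenE
    have "abs_uq (fg g) * pbw m a b = pbw m (Suc a) b"
      by (simp add: GenE pbw_def mult.assoc flip: uE.abs_eq uE_def)
    then show ?thesis using pbw_in_span by simp
  next
    case GenF
    then show ?thesis using uF_mult_pbw_in_span by (simp flip: uF_def)
  next
    case GenK
    then show ?thesis using scalar[OF uq_relations(7)] by (simp flip: uK_def)
  next
    case GenKinv
    then show ?thesis using scalar[OF uKinv_idem] by (simp flip: uKinv_def)
  next
    case (GenIdem n)
    have "idem n * idem k = scal (if n = k then 1 else 0) * idem k"
      by (simp add: uq_relations(6) scal_simps)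
    from scalar[OF this] show ?thesis by (simp add: GenIdem flip: idem_def idem.abs_eq)
  qed
qed

text \<open>
  The generators of the free algebra preserve the span of the monomials, and the span contains
  \<open>1\<^sub>m\<close>.
\<close>

lemma mult_idem_in_span_pbw: "u * idem m \<in> uq.span (range (\<lambda>(a, b). pbw m a b))" (is "_ \<in> ?S")
proof -
  obtain x where x: "u = abs_uq x" by (rule uq_cases)
  have word: "abs_uq (Poly_Mapping.single (Word gs) c) * idem m \<in> ?S" for gs c
  proof (induction gs)
    case Nil
    have "Poly_Mapping.single (Word []) c = fc c" by (simp add: fc_def zero_uword_def)
    then have "abs_uq (Poly_Mapping.single (Word []) c) * idem m = scal c * pbw m 0 0"
      by (simp add: pbw_def flip: scal.abs_eq)
    then show ?case using pbw_in_span by (simp add: uq.span_scale)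
  next
    case (Cons g gs)
    have "Poly_Mapping.single (Word (g # gs)) c = fg g * Poly_Mapping.single (Word gs) c"
      by (simp add: fg_def mult_single plus_uword_def)
    then have "abs_uq (Poly_Mapping.single (Word (g # gs)) c) * idem m
      = abs_uq (fg g) * (abs_uq (Poly_Mapping.single (Word gs) c) * idem m)"
      by (simp add: times_uq.abs_eq flip: mult.assoc)
    also have "\<dots> \<in> ?S"
      by (rule mult_span_left[OF _ Cons]) (auto simp: generator_mult_pbw_in_span)
    finally show ?case .
  qed
  have "abs_uq (\<Sum>w\<in>W. Poly_Mapping.single w (lookup x w)) * idem m \<in> ?S" if "finite W" for W
    using that
  proof (induction W)
    case empty
    then show ?case by (simp add: uq.span_zero flip: zero_uq_def)
  next
    case (insert w W)
    then show ?case
      using word[of "letters w" "lookup x w"] by (simp add: distrib_right uq.span_add flip: plus_uq.abs_eq)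
  qed
  from this[of "keys x"] show ?thesis by (simp add: x flip: free_alg_sum)
qed

lemma Udot_idem_iff: "w \<in> Udot_idem m \<longleftrightarrow> w * idem m = w"
proof
  assume "w \<in> Udot_idem m"
  then show "w * idem m = w" by (auto simp: Udot_idem_def mult.assoc uq_relations(6))
next
  assume w: "w * idem m = w"
  have "w * idem m * 1 \<in> Udot"
    unfolding Udot_def by (rule two_sided_ideal.base) auto
  then have "w \<in> Udot" by (simp add: w)
  then show "w \<in> Udot_idem m" unfolding Udot_idem_def using w by (metis (mono_tags, lifting) mem_Collect_eq)
qed



section \<open>Sequences of tensors and their limits\<close>

text \<open>
  The vectors \<open>v\<^sub>i\<^sub>j\<close>.  Those outside the range of indices of the finite-dimensional module are zero,
  so that the formulas for \<open>E\<close> and \<open>F\<close> hold for every \<open>p \<ge> -m\<close>, as the definition of asymptotic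
  vanishing requires, and not only for large \<open>p\<close>.
\<close>

definition tvec :: "int \<Rightarrow> nat \<Rightarrow> nat \<times> nat \<Rightarrow> (nat \<times> nat \<Rightarrow>\<^sub>0 Qq)" where
  "tvec m p = (\<lambda>(i, j). if i \<le> p \<and> int j \<le> int p + m then bvec (i, j) else 0)"

definition specialize :: "Qq \<Rightarrow> ('b \<Rightarrow>\<^sub>0 Qq poly) \<Rightarrow> ('b \<Rightarrow>\<^sub>0 Qq)" where
  "specialize t c = Poly_Mapping.map (\<lambda>f. poly f t) c"

text \<open>
  The coordinates of \<open>z p\<close> are the values at \<open>t = q\<^sup>-\<^sup>2\<^sup>p\<close> of finitely many polynomials, whose values at
  \<open>t = 0\<close> are the coordinates of \<open>L\<close>.
\<close>

definition tends :: "int \<Rightarrow> (nat \<Rightarrow> (nat \<times> nat \<Rightarrow>\<^sub>0 Qq)) \<Rightarrow> (nat \<times> nat \<Rightarrow>\<^sub>0 Qq) \<Rightarrow> bool" where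
  "tends m z L \<longleftrightarrow> (\<exists>c. L = specialize 0 c \<and>
     (\<forall>p. 0 \<le> int p + m \<longrightarrow> z p = lin (tvec m p) (specialize (q powi (- (2 * int p))) c)))"

lemma lookup_specialize [simp]:
  "lookup (specialize t c) k = poly (Poly_Mapping.lookup c k) t"
  by (simp add: specialize_def Poly_Mapping.map.rep_eq when_def)

lemma specialize_add: "specialize t (c + c') = specialize t c + specialize t c'"
  by (rule poly_mapping_eqI) (simp add: lookup_add)

lemma specialize_mult: "specialize t (Poly_Mapping.map ((*) f) c) = scale (poly f t) (specialize t c)"
  by (rule poly_mapping_eqI) (simp add: Poly_Mapping.map.rep_eq when_def)

lemma specialize_single: "specialize t (Poly_Mapping.single k 1) = bvec k"
  by (rule poly_mapping_eqI) (simp add: lookup_single when_def bvec_def)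

lemma tends_zero: "tends m (\<lambda>p. 0) 0"
proof -
  have "specialize t 0 = (0 :: nat \<times> nat \<Rightarrow>\<^sub>0 Qq)" for t
    by (rule poly_mapping_eqI) simp
  then show ?thesis unfolding tends_def by (intro exI[of _ 0]) simp
qed

lemma tends_cong:
  "tends m z L \<Longrightarrow> (\<And>p. 0 \<le> int p + m \<Longrightarrow> z' p = z p) \<Longrightarrow> tends m z' L"
  unfolding tends_def by auto

lemma tends_add: "tends m z L \<Longrightarrow> tends m z' L' \<Longrightarrow> tends m (\<lambda>p. z p + z' p) (L + L')"
  unfolding tends_def
proof (elim exE conjE)
  fix c c'
  assume "L = specialize 0 c" "L' = specialize 0 c'"
    "\<forall>p. 0 \<le> int p + m \<longrightarrow> z p = lin (tvec m p) (specialize (q powi (- (2 * int p))) c)"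
    "\<forall>p. 0 \<le> int p + m \<longrightarrow> z' p = lin (tvec m p) (specialize (q powi (- (2 * int p))) c')"
  then show "\<exists>c. L + L' = specialize 0 c \<and> (\<forall>p. 0 \<le> int p + m \<longrightarrow>
      z p + z' p = lin (tvec m p) (specialize (q powi (- (2 * int p))) c))"
    by (intro exI[of _ "c + c'"]) (simp add: specialize_add lin_add)
qed

lemma tends_poly_scale:
  "tends m z L \<Longrightarrow> tends m (\<lambda>p. scale (poly f (q powi (- (2 * int p)))) (z p)) (scale (poly f 0) L)"
  unfolding tends_def
proof (elim exE conjE)
  fix c
  assume "L = specialize 0 c"
    "\<forall>p. 0 \<le> int p + m \<longrightarrow> z p = lin (tvec m p) (specialize (q powi (- (2 * int p))) c)"
  then show "\<exists>c. scale (poly f 0) L = specialize 0 c \<and> (\<forall>p. 0 \<le> int p + m \<longrightarrow>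
      scale (poly f (q powi (- (2 * int p)))) (z p)
        = lin (tvec m p) (specialize (q powi (- (2 * int p))) c))"
    by (intro exI[of _ "Poly_Mapping.map ((*) f) c"]) (simp add: specialize_mult lin_scale)
qed

lemma tends_scale: "tends m z L \<Longrightarrow> tends m (\<lambda>p. scale c (z p)) (scale c L)"
  using tends_poly_scale[of m z L "[:c:]"] by simp

lemma tends_diff:
  assumes "tends m z L" "tends m z' L'"
  shows "tends m (\<lambda>p. z p - z' p) (L - L')"
  using tends_add[OF assms(1) tends_scale[OF assms(2), of "-1"]] by simp

lemma tends_sum:
  "(\<And>i. i \<in> S \<Longrightarrow> tends m (z i) (L i)) \<Longrightarrow> tends m (\<lambda>p. \<Sum>i\<in>S. z i p) (\<Sum>i\<in>S. L i)"
  by (induction S rule: infinite_finite_induct) (simp_all add: tends_zero tends_add)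

lemma tends_tvec: "tends m (\<lambda>p. tvec m p k) (bvec k)"
  unfolding tends_def
  by (intro exI[of _ "Poly_Mapping.single k 1"]) (simp add: specialize_single)

lemma lookup_lin_tvec:
  assumes "i \<le> p" "int j \<le> int p + m"
  shows "lookup (lin (tvec m p) v) (i, j) = lookup v (i, j)"
proof -
  have "lookup (lin (tvec m p) v) (i, j) = (\<Sum>k\<in>keys v. if k = (i, j) then lookup v k else 0)"
    unfolding lin_def lookup_sum
    by (rule sum.cong) (use assms in \<open>auto simp: tvec_def bvec_def lookup_single when_def split: prod.splits\<close>)
  then show ?thesis by (auto simp: in_keys_iff)
qed

text \<open>
  For large \<open>p\<close> the coordinate of \<open>v\<^sub>i\<^sub>j\<close> can be read off, so two polynomials that describe it agree at
  infinitely many points.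
\<close>

lemma tends_unique:
  assumes "tends m z L" "tends m z L'"
  shows "L = L'"
proof (rule poly_mapping_pair_eqI)
  fix i j
  obtain c where c: "L = specialize 0 c"
    "\<And>p. 0 \<le> int p + m \<Longrightarrow> z p = lin (tvec m p) (specialize (q powi (- (2 * int p))) c)"
    using assms(1) by (auto simp: tends_def)
  obtain c' where c': "L' = specialize 0 c'"
    "\<And>p. 0 \<le> int p + m \<Longrightarrow> z p = lin (tvec m p) (specialize (q powi (- (2 * int p))) c')"
    using assms(2) by (auto simp: tends_def)
  define f where "f = Poly_Mapping.lookup c (i, j) - Poly_Mapping.lookup c' (i, j)"
  \<comment> \<open>For these \<open>p\<close> the vector \<open>v\<^sub>i\<^sub>j\<close> is nonzero.\<close>
  define P where "P = {max i (nat (int j + \<bar>m\<bar>))..}"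
  have "poly f (q powi (- (2 * int p))) = 0" if "p \<in> P" for p
  proof -
    have p: "i \<le> p" "int j \<le> int p + m" "0 \<le> int p + m" using that by (auto simp: P_def)
    show ?thesis
      using lookup_lin_tvec[OF p(1,2), of "specialize (q powi (- (2 * int p))) c"]
        lookup_lin_tvec[OF p(1,2), of "specialize (q powi (- (2 * int p))) c'"] c(2)[OF p(3)] c'(2)[OF p(3)]
      by (simp add: f_def)
  qed
  then have "(\<lambda>p. q powi (- (2 * int p))) ` P \<subseteq> {x. poly f x = 0}" by auto
  moreover have "infinite ((\<lambda>p. q powi (- (2 * int p))) ` P)"
  proof -
    have "inj_on (\<lambda>p. q powi (- (2 * int p))) P" by (rule inj_onI) (simp add: q_powi_inj del: power_int_minus)
    moreover have "infinite P" by (simp add: P_def infinite_Ici)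
    ultimately show ?thesis using finite_imageD by blast
  qed
  ultimately have "f = 0" using poly_roots_finite[of f] finite_subset by blast
  then show "lookup L (i, j) = lookup L' (i, j)" by (simp add: c c' f_def)
qed

lemma tends_lin:
  assumes "\<And>k. tends m (\<lambda>p. lin (h p) (tvec m p k)) (N k)" "tends m z L"
  shows "tends m (\<lambda>p. lin (h p) (z p)) (lin N L)"
proof -
  obtain c where c: "L = specialize 0 c"
    "\<And>p. 0 \<le> int p + m \<Longrightarrow> z p = lin (tvec m p) (specialize (q powi (- (2 * int p))) c)"
    using assms(2) by (auto simp: tends_def)
  have lin: "lin g (specialize t c) =
    (\<Sum>k\<in>Poly_Mapping.keys c. scale (poly (Poly_Mapping.lookup c k) t) (g k))"
    for t and g :: "nat \<times> nat \<Rightarrow> (nat \<times> nat \<Rightarrow>\<^sub>0 Qq)"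
    by (subst lin_superset[of "Poly_Mapping.keys c"]) (auto simp: in_keys_iff)
  have "tends m (\<lambda>p. \<Sum>k\<in>Poly_Mapping.keys c.
      scale (poly (Poly_Mapping.lookup c k) (q powi (- (2 * int p)))) (lin (h p) (tvec m p k))) (lin N L)"
    unfolding c(1) lin by (intro tends_sum tends_poly_scale assms(1))
  then show ?thesis
    by (rule tends_cong) (simp add: c(2) lin lin_sum lin_scale)
qed

section \<open>The limits of the operators\<close>

definition limE :: "int \<Rightarrow> nat \<times> nat \<Rightarrow> (nat \<times> nat \<Rightarrow>\<^sub>0 Qq)" where
  "limE m = (\<lambda>(i, j). scale (qint (Suc i)) (bvec (Suc i, j)) +
     (if j = 0 then 0
      else scale (q powi (2 * int i - int j + 1 + m) / (q - inverse q)) (bvec (i, j - 1))))"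

definition limF :: "int \<Rightarrow> nat \<times> nat \<Rightarrow> (nat \<times> nat \<Rightarrow>\<^sub>0 Qq)" where
  "limF m = (\<lambda>(i, j). scale (qint (Suc j)) (bvec (i, Suc j)) +
     (if i = 0 then 0
      else scale (q powi (2 * int j - int i + 1 - m) / (q - inverse q)) (bvec (i - 1, j))))"

lemma q_powi_times_qint:
  "q powi x * qint k = (q powi (x + int k) - q powi (x - int k)) / (q - inverse q)"
  by (simp add: qint_def right_diff_distrib power_int_minus power_int_add power_int_diff divide_inverse)

lemma qint_0 [simp]: "qint 0 = 0"
  by (simp add: qint_def)

text \<open>
  The quantum integer \<open>[n-j+1]\<close>, with \<open>n = p + m\<close>, times the eigenvalue \<open>q\<^sup>2\<^sup>i\<^sup>-\<^sup>p\<close> of \<open>K\<close> is linear in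
  \<open>q\<^sup>-\<^sup>2\<^sup>p\<close>.  At the edge \<open>j = n + 1\<close> the left side is zero, and so is the right side because \<open>[0] = 0\<close>.
\<close>

lemma opE_tvec:
  assumes p: "0 \<le> int p + m"
  shows "lin (opE (TL m p)) (tvec m p (i, j)) = scale (qint (Suc i)) (tvec m p (Suc i, j)) +
    (if j = 0 then 0 else scale ((q powi (2 * int i - int j + 1 + m)
        - q powi (2 * int i + int j - 1 - m) * q powi (- (2 * int p))) / (q - inverse q))
      (tvec m p (i, j - 1)))"
proof -
  define n where "n = nat (int p + m)"
  have n: "int p + m = int n" using p by (simp add: n_def)
  have coeff: "q powi (2 * int i - int p) * qint (n + 1 - j) =
    (q powi (2 * int i - int j + 1 + m) - q powi (2 * int i + int j - 1 - m) * q powi (- (2 * int p)))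
      / (q - inverse q)" if "j \<le> n + 1"
  proof -
    have "m = int n - int p" using n by simp
    with that show ?thesis
      unfolding q_powi_times_qint
      by (simp add: of_nat_diff flip: power_int_add) (simp add: algebra_simps)
  qed
  have tvec: "tvec m p (i, j) = (if i \<le> p \<and> j \<le> n then bvec (i, j) else 0)" for i j
    by (simp add: tvec_def n)
  consider "p < i" | "i \<le> p" "j \<le> n" | "i \<le> p" "j = n + 1" | "n + 1 < j" by linarith
  then show ?thesis
  proof cases
    case 2
    have "lin (opE (TL m p)) (tvec m p (i, j)) = tens (opF (Lmod p) i) (bvec j)
      + tens (opKinv (Lmod p) i) (opE (Lmod n) j)"
      using 2 by (simp add: tvec TL_def tensor_def Lmod_omega_def n)
    also have "tens (opF (Lmod p) i) (bvec j) = scale (qint (Suc i)) (tvec m p (Suc i, j))"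
      using 2 by (simp add: tvec Lmod_def tens_simps)
    also have "tens (opKinv (Lmod p) i) (opE (Lmod n) j) =
      (if j = 0 then 0 else scale (q powi (2 * int i - int p) * qint (n + 1 - j)) (tvec m p (i, j - 1)))"
      using 2 by (auto simp: tvec Lmod_def tens_simps Suc_diff_le)
    also have "q powi (2 * int i - int p) * qint (n + 1 - j) =
        (q powi (2 * int i - int j + 1 + m) - q powi (2 * int i + int j - 1 - m) * q powi (- (2 * int p)))
          / (q - inverse q)"
      using 2 by (intro coeff) simp
    finally show ?thesis .
  qed (use coeff in \<open>auto simp: tvec\<close>)
qed

lemma opF_tvec:
  assumes p: "0 \<le> int p + m"
  shows "lin (opF (TL m p)) (tvec m p (i, j)) = scale (qint (Suc j)) (tvec m p (i, Suc j)) +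
    (if i = 0 then 0 else scale ((q powi (2 * int j - int i + 1 - m)
        - q powi (2 * int j + int i - 1 - m) * q powi (- (2 * int p))) / (q - inverse q))
      (tvec m p (i - 1, j)))"
proof -
  define n where "n = nat (int p + m)"
  have n: "int p + m = int n" using p by (simp add: n_def)
  have coeff: "q powi (2 * int j - int n) * qint (p + 1 - i) =
    (q powi (2 * int j - int i + 1 - m) - q powi (2 * int j + int i - 1 - m) * q powi (- (2 * int p)))
      / (q - inverse q)" if "i \<le> p + 1"
  proof -
    have "m = int n - int p" using n by simp
    with that show ?thesis
      unfolding q_powi_times_qint
      by (simp add: of_nat_diff flip: power_int_add) (simp add: algebra_simps)
  qed
  have tvec: "tvec m p (i, j) = (if i \<le> p \<and> j \<le> n then bvec (i, j) else 0)" for i j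
    by (simp add: tvec_def n)
  consider "n < j" | "j \<le> n" "i \<le> p" | "j \<le> n" "i = p + 1" | "p + 1 < i" by linarith
  then show ?thesis
  proof cases
    case 2
    have "lin (opF (TL m p)) (tvec m p (i, j)) = tens (opE (Lmod p) i) (opKinv (Lmod n) j)
      + tens (bvec i) (opF (Lmod n) j)"
      using 2 by (simp add: tvec TL_def tensor_def Lmod_omega_def n)
    also have "tens (bvec i) (opF (Lmod n) j) = scale (qint (Suc j)) (tvec m p (i, Suc j))"
      using 2 by (simp add: tvec Lmod_def tens_simps)
    also have "tens (opE (Lmod p) i) (opKinv (Lmod n) j) =
      (if i = 0 then 0 else scale (q powi (2 * int j - int n) * qint (p + 1 - i)) (tvec m p (i - 1, j)))"
      using 2 by (auto simp: tvec Lmod_def tens_simps Suc_diff_le mult.commute)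
    also have "q powi (2 * int j - int n) * qint (p + 1 - i) =
        (q powi (2 * int j - int i + 1 - m) - q powi (2 * int j + int i - 1 - m) * q powi (- (2 * int p)))
          / (q - inverse q)"
      using 2 by (intro coeff) simp
    finally show ?thesis by (simp only: add.commute)
  qed (use coeff in \<open>auto simp: tvec\<close>)
qed

lemma tends_opE: "tends m (\<lambda>p. lin (opE (TL m p)) (tvec m p k)) (limE m k)"
proof (cases k)
  case (Pair i j)
  define f where "f = smult (1 / (q - inverse q))
    [:q powi (2 * int i - int j + 1 + m), - (q powi (2 * int i + int j - 1 - m)):]"
  have "tends m (\<lambda>p. scale (qint (Suc i)) (tvec m p (Suc i, j)) + (if j = 0 then 0 else
      scale (poly f (q powi (- (2 * int p)))) (tvec m p (i, j - 1)))) (limE m (i, j))"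
    using tends_add[OF tends_scale[OF tends_tvec] tends_poly_scale[OF tends_tvec, of m f "(i, j - 1)"], of "qint (Suc i)" "(Suc i, j)"]
      tends_scale[OF tends_tvec, of m "qint (Suc i)" "(Suc i, j)"]
    by (cases "j = 0") (simp_all add: limE_def f_def)
  then show ?thesis unfolding Pair
    by (rule tends_cong) (simp add: opE_tvec f_def mult.commute diff_divide_distrib)
qed

lemma tends_opF: "tends m (\<lambda>p. lin (opF (TL m p)) (tvec m p k)) (limF m k)"
proof (cases k)
  case (Pair i j)
  define f where "f = smult (1 / (q - inverse q))
    [:q powi (2 * int j - int i + 1 - m), - (q powi (2 * int j + int i - 1 - m)):]"
  have "tends m (\<lambda>p. scale (qint (Suc j)) (tvec m p (i, Suc j)) + (if i = 0 then 0 else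
      scale (poly f (q powi (- (2 * int p)))) (tvec m p (i - 1, j)))) (limF m (i, j))"
    using tends_add[OF tends_scale[OF tends_tvec] tends_poly_scale[OF tends_tvec, of m f "(i - 1, j)"], of "qint (Suc j)" "(i, Suc j)"]
      tends_scale[OF tends_tvec, of m "qint (Suc j)" "(i, Suc j)"]
    by (cases "i = 0") (simp_all add: limF_def f_def)
  then show ?thesis unfolding Pair
    by (rule tends_cong) (simp add: opF_tvec f_def mult.commute diff_divide_distrib)
qed

section \<open>The straightening coefficients\<close>

text \<open>
  The coefficients of the first formula; those of the second are obtained by exchanging \<open>a\<close> with \<open>b\<close> and
  \<open>m\<close> with \<open>-m\<close>.
\<close>

definition straight_coeff :: "nat \<Rightarrow> nat \<Rightarrow> int \<Rightarrow> nat \<Rightarrow> Qq" where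
  "straight_coeff a b m s = q powi (- (int s)\<^sup>2 + int s * (int a - int b + m)) / qpoch s"

definition straight_sum :: "(nat \<Rightarrow> nat \<Rightarrow> ('b \<Rightarrow>\<^sub>0 Qq)) \<Rightarrow> nat \<Rightarrow> nat \<Rightarrow> int \<Rightarrow> ('b \<Rightarrow>\<^sub>0 Qq)" where
  "straight_sum v a b m = (\<Sum>s=0..min a b. scale (straight_coeff a b m s) (v (a - s) (b - s)))"

text \<open>
  A Pascal rule.  Both coefficients on the left are monomial multiples of the one on the right, up to
  the factor \<open>1 - q\<^sup>-\<^sup>2\<^sup>s\<^sup>-\<^sup>2\<close> of the Pochhammer symbol; cleared of these and of the denominator
  \<open>q - q\<^sup>-\<^sup>1\<close>, the identity is
  \<open>(q\<^sup>a\<^sup>-\<^sup>2\<^sup>s\<^sup>-\<^sup>1 - q\<^sup>-\<^sup>a\<^sup>-\<^sup>1) + (q\<^sup>a\<^sup>+\<^sup>1 - q\<^sup>a\<^sup>-\<^sup>2\<^sup>s\<^sup>-\<^sup>1) = q\<^sup>a\<^sup>+\<^sup>1 - q\<^sup>-\<^sup>a\<^sup>-\<^sup>1\<close>.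
\<close>

lemma straight_coeff_step:
  assumes "s \<le> a"
  shows "straight_coeff a b m (Suc s) * qint (a - s) +
      straight_coeff a b m s * (q powi (2 * (int a - int s) - (int b - int s) + 1 + m) / (q - inverse q))
    = qint (Suc a) * straight_coeff (Suc a) b m (Suc s)"
proof -
  define C where "C = straight_coeff (Suc a) b m (Suc s)"
  define x where "x = q powi (- (2 * int (Suc s)))"
  have x: "1 - x \<noteq> 0" using q_powi_inj[of "- (2 * int (Suc s))" 0] by (auto simp: x_def)
  have 1: "straight_coeff a b m (Suc s) = C * q powi (- int (Suc s))"
    by (simp add: C_def straight_coeff_def power2_eq_square algebra_simps flip: power_int_add)
  have poch: "qpoch (Suc s) = qpoch s * (1 - x)" by (simp add: qpoch_def x_def)
  have "q powi (- (int s)\<^sup>2 + int s * (int a - int b + m)) =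
      q powi (- (int (Suc s))\<^sup>2 + int (Suc s) * (int (Suc a) - int b + m)) * q powi (int s - int a + int b - m)"
    by (simp add: power2_eq_square algebra_simps flip: power_int_add)
  then have 2: "straight_coeff a b m s = C * (q powi (int s - int a + int b - m) * (1 - x))"
    using x by (simp add: C_def straight_coeff_def poch)
  have "q powi (- int (Suc s)) * qint (a - s) + q powi (int s - int a + int b - m) * (1 - x) *
      (q powi (2 * (int a - int s) - (int b - int s) + 1 + m) / (q - inverse q)) = qint (Suc a)"
    unfolding q_powi_times_qint using assms
    by (simp add: qint_def x_def of_nat_diff algebra_simps diff_divide_distrib flip: power_int_add)
  then show ?thesis unfolding 1 2 C_def[symmetric]
    by (metis (no_types, opaque_lifting) distrib_left mult.assoc mult.commute)
qed

text \<open>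
  The induction step of the \<open>q\<close>-binomial formula.  It is stated for an arbitrary family \<open>v\<close> so that it
  applies to \<open>E\<close> with \<open>v\<^sub>i\<^sub>j\<close> and to \<open>F\<close> with the transposed family \<open>v\<^sub>j\<^sub>i\<close>.
\<close>

lemma lin_straight_sum:
  assumes f: "\<And>i j. lin f (v i j) = scale (qint (Suc i)) (v (Suc i) j) +
    (if j = 0 then 0 else scale (q powi (2 * int i - int j + 1 + m) / (q - inverse q)) (v i (j - 1)))"
  shows "lin f (straight_sum v a b m) = scale (qint (Suc a)) (straight_sum v (Suc a) b m)"
proof -
  let ?c = "straight_coeff a b m"
  define M where "M = min (Suc a) b"
  define d where "d s = q powi (2 * (int a - int s) - (int b - int s) + 1 + m) / (q - inverse q)" for s
  define G where "G s = scale (?c (s - 1) * d (s - 1)) (v (Suc a - s) (b - s))" for s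
  have "lin f (straight_sum v a b m) =
      (\<Sum>s=0..min a b. scale (?c s * qint (Suc a - s)) (v (Suc a - s) (b - s)))
    + (\<Sum>s=0..min a b. if s = b then 0 else G (Suc s))"
    unfolding straight_sum_def lin_sum sum.distrib[symmetric]
    by (rule sum.cong) (auto simp: lin_scale f pm.scale_right_distrib Suc_diff_le G_def d_def of_nat_diff)
  \<comment> \<open>If \<open>a < b\<close>, a term with \<open>s = a + 1\<close> is added, whose coefficient is \<open>[0] = 0\<close>.\<close>
  also have "(\<Sum>s=0..min a b. scale (?c s * qint (Suc a - s)) (v (Suc a - s) (b - s)))
      = (\<Sum>s=0..M. scale (?c s * qint (Suc a - s)) (v (Suc a - s) (b - s)))"
    by (rule sum.mono_neutral_left) (auto simp: M_def le_Suc_eq)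
  also have "\<dots> = scale (?c 0 * qint (Suc a)) (v (Suc a) b)
      + (\<Sum>s=1..M. scale (?c s * qint (Suc a - s)) (v (Suc a - s) (b - s)))"
    by (simp add: sum.atLeast_Suc_atMost)
  \<comment> \<open>\<open>G\<close> collects the terms in which the second index drops, shifted by one so that both sums run over the same vectors.\<close>
  also have "(\<Sum>s=0..min a b. if s = b then 0 else G (Suc s)) = (\<Sum>s<M. G (Suc s))"
    by (rule sum.mono_neutral_cong_right) (auto simp: M_def)
  also have "\<dots> = (\<Sum>s=1..M. G s)" by (simp add: sum.atLeast1_atMost_eq)
  also have "scale (?c 0 * qint (Suc a)) (v (Suc a) b)
      + (\<Sum>s=1..M. scale (?c s * qint (Suc a - s)) (v (Suc a - s) (b - s))) + (\<Sum>s=1..M. G s)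
    = scale (?c 0 * qint (Suc a)) (v (Suc a) b) +
      (\<Sum>s=1..M. scale (qint (Suc a) * straight_coeff (Suc a) b m s) (v (Suc a - s) (b - s)))"
  proof -
    have "scale (?c s * qint (Suc a - s)) (v (Suc a - s) (b - s)) + G s =
      scale (qint (Suc a) * straight_coeff (Suc a) b m s) (v (Suc a - s) (b - s))" if s: "s \<in> {1..M}" for s
    proof -
      obtain s' where "s = Suc s'" "s' \<le> a" using s by (cases s) (auto simp: M_def)
      then show ?thesis
        using straight_coeff_step[of s' a b m] by (simp add: G_def d_def flip: pm.scale_left_distrib)
    qed
    then show ?thesis by (simp add: add.assoc flip: sum.distrib)
  qed
  also have "\<dots> = scale (qint (Suc a)) (straight_sum v (Suc a) b m)"
    by (simp add: straight_sum_def sum.atLeast_Suc_atMost[of 0] M_def pm.scale_right_distrib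
        pm.scale_sum_right straight_coeff_def mult.commute)
  finally show ?thesis .
qed



section \<open>The limit of an element\<close>

lemma qfact_nonzero: "qfact a \<noteq> 0"
  unfolding qfact_def by (simp add: prod_zero_iff qint_nonzero)

lemma qfact_Suc: "qfact (Suc a) = qint (Suc a) * qfact a"
  by (simp add: qfact_def mult.commute)

lemma xi_carrier: "xi \<in> carrier (Lmod_omega p)"
  by (simp add: xi_def bvec_carrier Lmod_omega_def Lmod_def)

lemma eta_carrier: "eta \<in> carrier (Lmod n)"
  by (simp add: eta_def bvec_carrier Lmod_def)

lemma act_scal_mult:
  assumes "weight_module M" "v \<in> carrier M"
  shows "act M (scal c * u) v = scale c (act M u v)"
  using assms by (simp add: act_simps act_closed)

lemma act_uE_power_xi:
  "act (Lmod_omega p) (uE ^ i) xi = scale (qfact i) (if i \<le> p then bvec i else 0)"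
proof (induction i)
  case 0
  show ?case
    by (simp add: act_simps[OF Lmod_omega_weight_module xi_carrier]) (simp add: xi_def qfact_def)
next
  case (Suc i)
  have eq: "act (Lmod_omega p) (uE ^ Suc i) xi = lin (opF (Lmod p)) (act (Lmod_omega p) (uE ^ i) xi)"
    by (simp add: act_simps[OF Lmod_omega_weight_module] xi_carrier act_closed
        Lmod_omega_weight_module) (simp add: Lmod_omega_def)
  show ?case unfolding eq Suc by (simp add: lin_scale qfact_Suc Lmod_def mult.commute)
qed

lemma act_uF_power_eta:
  "act (Lmod n) (uF ^ j) eta = scale (qfact j) (if j \<le> n then bvec j else 0)"
proof (induction j)
  case 0
  show ?case
    by (simp add: act_simps[OF Lmod_weight_module eta_carrier]) (simp add: eta_def qfact_def)
next
  case (Suc j)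
  have eq: "act (Lmod n) (uF ^ Suc j) eta = lin (opF (Lmod n)) (act (Lmod n) (uF ^ j) eta)"
    by (simp add: act_simps[OF Lmod_weight_module] eta_carrier act_closed Lmod_weight_module)
  show ?case unfolding eq Suc by (simp add: lin_scale qfact_Suc Lmod_def mult.commute)
qed

lemma act_divE_xi: "act (Lmod_omega p) (divE i) xi = (if i \<le> p then bvec i else 0)"
  by (simp add: divE_def act_scal_mult[OF Lmod_omega_weight_module xi_carrier]
      act_uE_power_xi qfact_nonzero)

lemma act_divF_eta: "act (Lmod n) (divF j) eta = (if j \<le> n then bvec j else 0)"
  by (simp add: divF_def act_scal_mult[OF Lmod_weight_module eta_carrier]
      act_uF_power_eta qfact_nonzero)

lemma tens_divE_divF:
  assumes "0 \<le> int p + m"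
  shows "tens (act (Lmod_omega p) (divE i) xi) (act (Lmod (nat (int p + m))) (divF j) eta)
    = tvec m p (i, j)"
  using assms by (auto simp: act_divE_xi act_divF_eta tvec_def le_nat_iff)

lemma vacuum_carrier: "tens xi eta \<in> carrier (TL m p)"
  by (simp add: TL_def tens_carrier xi_carrier eta_carrier)

definition has_limit :: "int \<Rightarrow> uq \<Rightarrow> (nat \<times> nat \<Rightarrow>\<^sub>0 Qq) \<Rightarrow> bool" where
  "has_limit m u L \<longleftrightarrow> tends m (\<lambda>p. act (TL m p) u (tens xi eta)) L"

lemma has_limit_add: "has_limit m u L \<Longrightarrow> has_limit m v L' \<Longrightarrow> has_limit m (u + v) (L + L')"
  by (simp add: has_limit_def act_simps[OF TL_weight_module vacuum_carrier] tends_add)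

lemma has_limit_scal: "has_limit m u L \<Longrightarrow> has_limit m (scal c * u) (scale c L)"
  by (simp add: has_limit_def act_scal_mult[OF TL_weight_module vacuum_carrier] tends_scale)

lemma has_limit_zero: "has_limit m 0 0"
  by (simp add: has_limit_def act_simps[OF TL_weight_module vacuum_carrier] tends_zero)

lemma has_limit_diff:
  assumes "has_limit m u L" "has_limit m v L'"
  shows "has_limit m (u - v) (L - L')"
  using has_limit_add[OF assms(1) has_limit_scal[OF assms(2), of "-1"]]
  by (simp only: uq.scale_minus_left uq.scale_one pm.scale_minus_left pm.scale_one
      add_uminus_conv_diff)

lemma has_limit_sum:
  "(\<And>i. i \<in> S \<Longrightarrow> has_limit m (u i) (L i)) \<Longrightarrow> has_limit m (\<Sum>i\<in>S. u i) (\<Sum>i\<in>S. L i)"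
  by (induction S rule: infinite_finite_induct) (simp_all add: has_limit_zero has_limit_add)

lemma has_limit_uE: "has_limit m u L \<Longrightarrow> has_limit m (uE * u) (lin (limE m) L)"
  using tends_lin[OF tends_opE]
  by (simp add: has_limit_def act_simps[OF TL_weight_module] vacuum_carrier act_closed
      TL_weight_module)

lemma has_limit_uF: "has_limit m u L \<Longrightarrow> has_limit m (uF * u) (lin (limF m) L)"
  using tends_lin[OF tends_opF]
  by (simp add: has_limit_def act_simps[OF TL_weight_module] vacuum_carrier act_closed
      TL_weight_module)

lemma act_idem_vacuum:
  assumes "0 \<le> int p + m"
  shows "act (TL m p) (idem m) (tens xi eta) = tens xi eta"
proof -
  have "lin (opK (TL m p)) (tens xi eta) = scale (q powi m) (tens xi eta)"
    using assms
    by (simp add: TL_def tensor_def Lmod_omega_def xi_def eta_def Lmod_def tens_simps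
        flip: power_int_add)
  then have "tens xi eta \<in> wt_space (TL m p) m"
    by (simp add: wt_space_def vacuum_carrier)
  then show ?thesis
    by (simp add: act_simps[OF TL_weight_module vacuum_carrier] wt_proj_eqI pm.span_zero)
qed

lemma has_limit_idem: "has_limit m (idem m) (bvec (0, 0))"
  unfolding has_limit_def
  by (rule tends_cong[OF tends_tvec]) (simp add: act_idem_vacuum, simp add: tvec_def xi_def eta_def)

lemma divE_Suc: "divE (Suc a) = scal (inverse (qint (Suc a))) * uE * divE a"
  by (simp only: divE_def power_Suc qfact_Suc inverse_mult_distrib scal_simps(2) mult.assoc
      scal_left_commute[of uE])

lemma divF_Suc: "divF (Suc b) = scal (inverse (qint (Suc b))) * uF * divF b"
  by (simp only: divF_def power_Suc qfact_Suc inverse_mult_distrib scal_simps(2) mult.assoc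
      scal_left_commute[of uF])

lemma straight_sum_0 [simp]: "straight_sum v 0 b m = v 0 b" "straight_sum v a 0 m = v a 0"
  by (simp_all add: straight_sum_def straight_coeff_def qpoch_def)

lemma has_limit_divE:
  assumes "has_limit m u (bvec (0, b))"
  shows "has_limit m (divE a * u) (straight_sum (\<lambda>i j. bvec (i, j)) a b m)"
proof (induction a)
  case 0
  show ?case using assms by (simp add: divE_def qfact_def scal_simps)
next
  case (Suc a)
  have "lin (limE m) (straight_sum (\<lambda>i j. bvec (i, j)) a b m)
      = scale (qint (Suc a)) (straight_sum (\<lambda>i j. bvec (i, j)) (Suc a) b m)"
    by (rule lin_straight_sum) (simp add: limE_def)
  then show ?case
    using has_limit_scal[OF has_limit_uE[OF Suc], of "inverse (qint (Suc a))"]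
    by (simp add: divE_Suc mult.assoc qint_nonzero)
qed

text \<open>
  The transposed family and the weight \<open>-m\<close> turn the limit of \<open>F\<close> into that of \<open>E\<close>.
\<close>

lemma has_limit_divF:
  assumes "has_limit m u (bvec (a, 0))"
  shows "has_limit m (divF b * u) (straight_sum (\<lambda>j i. bvec (i, j)) b a (- m))"
proof (induction b)
  case 0
  show ?case using assms by (simp add: divF_def qfact_def scal_simps)
next
  case (Suc b)
  have "lin (limF m) (straight_sum (\<lambda>j i. bvec (i, j)) b a (- m))
      = scale (qint (Suc b)) (straight_sum (\<lambda>j i. bvec (i, j)) (Suc b) a (- m))"
    by (rule lin_straight_sum) (simp add: limF_def)
  then show ?case
    using has_limit_scal[OF has_limit_uF[OF Suc], of "inverse (qint (Suc b))"]
    by (simp add: divF_Suc mult.assoc qint_nonzero)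
qed

lemma has_limit_divE_divF:
  "has_limit m (divE a * divF b * idem m) (straight_sum (\<lambda>i j. bvec (i, j)) a b m)"
  using has_limit_divE[of m "divF b * idem m" b a] has_limit_divF[OF has_limit_idem, where b = b]
  by (simp add: mult.assoc)

lemma has_limit_divF_divE:
  "has_limit m (divF b * divE a * idem m) (straight_sum (\<lambda>j i. bvec (i, j)) b a (- m))"
  using has_limit_divF[of m "divE a * idem m" a b] has_limit_divE[OF has_limit_idem, where a = a]
  by (simp add: mult.assoc)

section \<open>The elements with a single limit vector\<close>

text \<open>
  The inverse of the triangular system that expresses the limits of the \<open>E\<^sup>(\<^sup>a\<^sup>) F\<^sup>(\<^sup>b\<^sup>) 1\<^sub>m\<close> in the
  vectors \<open>v\<^sub>i\<^sub>j\<close>.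
\<close>

function basis_lift :: "int \<Rightarrow> nat \<Rightarrow> nat \<Rightarrow> uq" where
  "basis_lift m a b = divE a * divF b * idem m
     - (\<Sum>s=1..min a b. scal (straight_coeff a b m s) * basis_lift m (a - s) (b - s))"
  by pat_completeness auto
termination by (relation "measure (\<lambda>(m, a, b). a)") auto

declare basis_lift.simps [simp del]

lemma divE_divF_eq_sum_basis_lift:
  "divE a * divF b * idem m = (\<Sum>s=0..min a b. scal (straight_coeff a b m s) * basis_lift m (a - s) (b - s))"
proof -
  have "straight_coeff a b m 0 = 1" by (simp add: straight_coeff_def qpoch_def)
  then show ?thesis
    using basis_lift.simps[of m a b] by (simp add: sum.atLeast_Suc_atMost scal_simps)
qed

lemma has_limit_basis_lift: "has_limit m (basis_lift m a b) (bvec (a, b))"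
proof (induction a arbitrary: b rule: less_induct)
  case (less a)
  have "has_limit m (basis_lift m a b) (straight_sum (\<lambda>i j. bvec (i, j)) a b m
      - (\<Sum>s=1..min a b. scale (straight_coeff a b m s) (bvec (a - s, b - s))))"
    unfolding basis_lift.simps[of m a b]
    by (intro has_limit_diff has_limit_divE_divF has_limit_sum has_limit_scal less) auto
  also have "straight_sum (\<lambda>i j. bvec (i, j)) a b m
      - (\<Sum>s=1..min a b. scale (straight_coeff a b m s) (bvec (a - s, b - s))) = bvec (a, b)"
    by (simp add: straight_sum_def sum.atLeast_Suc_atMost straight_coeff_def qpoch_def)
  finally show ?case .
qed

lemma basis_lift_idem: "basis_lift m a b * idem m = basis_lift m a b"
proof (induction a arbitrary: b rule: less_induct)
  case (less a)
  have "(\<Sum>s=1..min a b. scal (straight_coeff a b m s) * basis_lift m (a - s) (b - s)) * idem m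
      = (\<Sum>s=1..min a b. scal (straight_coeff a b m s) * basis_lift m (a - s) (b - s))"
    unfolding sum_distrib_right
    by (rule sum.cong) (auto simp: mult.assoc less)
  then show ?case
    by (subst (1 2) basis_lift.simps) (simp add: left_diff_distrib mult.assoc uq_relations(6))
qed

text \<open>
  The map \<open>\<Phi>\<close> that sends \<open>v\<^sub>a\<^sub>b\<close> to its lift is linear, and it sends the limit of
  \<open>E\<^sup>(\<^sup>a\<^sup>) F\<^sup>(\<^sup>b\<^sup>) 1\<^sub>m\<close> back to \<open>E\<^sup>(\<^sup>a\<^sup>) F\<^sup>(\<^sup>b\<^sup>) 1\<^sub>m\<close>.  These elements span, so \<open>\<Phi>\<close> recovers every element
  from its limit.
\<close>

lemma limit_determines_element:
  assumes "w \<in> Udot_idem m"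
  shows "\<exists>L. has_limit m w L \<and> w = (\<Sum>k\<in>keys L. scal (lookup L k) * basis_lift m (fst k) (snd k))"
proof -
  define \<Phi> where "\<Phi> L = (\<Sum>k\<in>keys L. scal (lookup L k) * basis_lift m (fst k) (snd k))" for L
  have \<Phi>: "\<Phi> L = (\<Sum>k\<in>S. scal (lookup L k) * basis_lift m (fst k) (snd k))"
    if "finite S" "keys L \<subseteq> S" for L S
    unfolding \<Phi>_def
    by (rule sum.mono_neutral_left) (use that in \<open>auto simp: in_keys_iff scal_simps\<close>)
  have \<Phi>_step: "\<Phi> (scale c L + L') = scal c * \<Phi> L + \<Phi> L'" for c L L'
  proof -
    define S where "S = keys L \<union> keys L'"
    have S: "finite S" "keys L \<subseteq> S" "keys L' \<subseteq> S" "keys (scale c L + L') \<subseteq> S"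
      by (auto simp: S_def in_keys_iff lookup_add)
    show ?thesis
      by (simp add: \<Phi>[OF S(1)] S lookup_add uq.scale_left_distrib sum.distrib uq.scale_sum_right)
  qed
  have pbw: "\<exists>L. has_limit m (divE a * divF b * idem m) L \<and> divE a * divF b * idem m = \<Phi> L" for a b
  proof -
    have single: "\<Phi> (bvec k) = basis_lift m (fst k) (snd k)" for k by (simp add: \<Phi>_def bvec_def scal_simps)
    have "\<Phi> (\<Sum>s\<in>S. scale (f s) (bvec (g s))) = (\<Sum>s\<in>S. scal (f s) * basis_lift m (fst (g s)) (snd (g s)))"
      if "finite S" for S :: "nat set" and f g
      using that single by (induction S) (simp_all add: \<Phi>_step, simp add: \<Phi>_def)
    from this[of "{0..min a b}" "straight_coeff a b m" "\<lambda>s. (a - s, b - s)"]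
    have "\<Phi> (straight_sum (\<lambda>i j. bvec (i, j)) a b m) = divE a * divF b * idem m"
      by (simp add: straight_sum_def divE_divF_eq_sum_basis_lift)
    then show ?thesis using has_limit_divE_divF by metis
  qed
  have "w * idem m \<in> uq.span (range (\<lambda>(a, b). pbw m a b))" by (rule mult_idem_in_span_pbw)
  then have "\<exists>L. has_limit m (w * idem m) L \<and> w * idem m = \<Phi> L"
  proof (induction rule: uq.span_induct_alt)
    case base
    show ?case by (intro exI[of _ 0]) (simp add: has_limit_zero \<Phi>_def)
  next
    case (step c x y)
    then obtain a b where x: "x = pbw m a b" by auto
    have x: "x = scal (qfact a * qfact b) * (divE a * divF b * idem m)"
    proof -
      have "qfact a * (qfact b * (inverse (qfact a) * inverse (qfact b))) = 1"
        using qfact_nonzero by (simp add: field_simps)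
      then show ?thesis
        by (simp add: x pbw_def divE_def divF_def mult.assoc scal_left_commute[of "uE ^ a"]
            scal_simps flip: scal_simps(2))
    qed
    from pbw[of a b] step.IH obtain L L' where
      "has_limit m (divE a * divF b * idem m) L" "divE a * divF b * idem m = \<Phi> L"
      "has_limit m y L'" "y = \<Phi> L'" by blast
    then show ?case
      by (intro exI[of _ "scale (c * (qfact a * qfact b)) L + L'"])
        (auto simp: x \<Phi>_step intro!: has_limit_add has_limit_scal simp flip: mult.assoc scal_simps(2))
  qed
  then show ?thesis using assms by (simp add: Udot_idem_iff \<Phi>_def)
qed

lemma Udot_idem_eqI:
  assumes "u \<in> Udot_idem m" "v \<in> Udot_idem m" "has_limit m u L" "has_limit m v L"
  shows "u = v"
  using limit_determines_element[OF assms(1)] limit_determines_element[OF assms(2)] assms(3,4)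
  unfolding has_limit_def by (metis tends_unique)

section \<open>Asymptotically zero sequences\<close>

lemma small_coeff_imp_poly:
  assumes "small_coeff c"
  obtains f where "poly f 0 = 0" "\<And>p. c p = poly f (q powi (- (2 * int p)))"
proof -
  obtain S f where S: "finite S" "S \<subseteq> {1..}" "\<And>p. c p = (\<Sum>s\<in>S. f s * q powi (- (2 * int s * int p)))"
    using assms by (auto simp: small_coeff_def)
  show ?thesis
  proof
    show "poly (\<Sum>s\<in>S. monom (f s) s) 0 = 0"
      using S(2) by (auto simp: poly_sum poly_monom power_0_left intro!: sum.neutral)
    show "c p = poly (\<Sum>s\<in>S. monom (f s) s) (q powi (- (2 * int p)))" for p
      unfolding S(3) poly_sum poly_monom
      by (rule sum.cong) (simp_all add: mult_ac flip: power_int_mult power_int_of_nat)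
  qed
qed

lemma poly_imp_small_coeff:
  assumes "poly f 0 = 0"
  shows "small_coeff (\<lambda>p. poly f (q powi (- (2 * int p))))"
  unfolding small_coeff_def
proof (intro exI conjI allI)
  show "finite {1..degree f}" "{1..degree f} \<subseteq> {1..}" by auto
  fix p
  have "poly f (q powi (- (2 * int p))) = (\<Sum>s=0..degree f. coeff f s * (q powi (- (2 * int p))) ^ s)"
    by (simp add: poly_altdef atMost_atLeast0)
  also have "\<dots> = (\<Sum>s=1..degree f. coeff f s * (q powi (- (2 * int p))) ^ s)"
    using assms by (simp add: sum.atLeast_Suc_atMost poly_0_coeff_0)
  also have "\<dots> = (\<Sum>s=1..degree f. coeff f s * q powi (- (2 * int s * int p)))"
    by (rule sum.cong) (simp_all add: mult_ac flip: power_int_mult power_int_of_nat)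
  finally show "poly f (q powi (- (2 * int p))) = \<dots>" .
qed

text \<open>
  By bilinearity it suffices to treat powers of \<open>E\<close> and \<open>F\<close>, which produce multiples of the \<open>v\<^sub>i\<^sub>j\<close>.
\<close>

lemma tens_act_tends:
  assumes "x \<in> Uplus" "y \<in> Uminus"
  shows "\<exists>L. tends m (\<lambda>p. tens (act (Lmod_omega p) x xi) (act (Lmod (nat (int p + m))) y eta)) L"
proof -
  let ?z = "\<lambda>x y p. tens (act (Lmod_omega p) x xi) (act (Lmod (nat (int p + m))) y eta)"
  have x: "x \<in> uq.span (range (\<lambda>i. uE ^ i))" and y: "y \<in> uq.span (range (\<lambda>j. uF ^ j))"
    using assms subalgebra_subset_span_powers by (auto simp: Uplus_def Uminus_def)
  have xy: "\<exists>L. tends m (?z (uE ^ i) (uF ^ j)) L" for i j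
  proof -
    have "tends m (?z (uE ^ i) (uF ^ j)) (scale (qfact i * qfact j) (bvec (i, j)))"
      by (rule tends_cong[OF tends_scale[OF tends_tvec]])
        (auto simp: act_uE_power_xi act_uF_power_eta tens_simps tvec_def le_nat_iff mult.commute)
    then show ?thesis by blast
  qed
  have "\<exists>L. tends m (?z (uE ^ i) y) L" for i
    using y
  proof (induction rule: uq.span_induct_alt)
    case base
    show ?case using tends_zero by (auto simp: act_simps[OF Lmod_weight_module eta_carrier])
  next
    case (step c u v)
    then obtain j L' where "u = uF ^ j" and L': "tends m (?z (uE ^ i) v) L'" by blast
    moreover obtain L where "tends m (?z (uE ^ i) (uF ^ j)) L" using xy by blast
    ultimately have "tends m (?z (uE ^ i) (scal c * u + v)) (scale c L + L')"
      by (simp add: act_simps[OF Lmod_weight_module] eta_carrier act_closed Lmod_weight_module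
          tens_simps tends_add tends_scale)
    then show ?case by blast
  qed
  note i = this
  show ?thesis
    using x
  proof (induction rule: uq.span_induct_alt)
    case base
    show ?case using tends_zero by (auto simp: act_simps[OF Lmod_omega_weight_module xi_carrier])
  next
    case (step c u v)
    then obtain i L' where "u = uE ^ i" and L': "tends m (?z v y) L'" by blast
    moreover obtain L where "tends m (?z (uE ^ i) y) L" using i by blast
    ultimately have "tends m (?z (scal c * u + v) y) (scale c L + L')"
      by (simp add: act_simps[OF Lmod_omega_weight_module] xi_carrier act_closed
          Lmod_omega_weight_module tens_simps tends_add tends_scale)
    then show ?case by blast
  qed
qed

lemma tends_small_scale:
  assumes "small_coeff c" "tends m z L"
  shows "tends m (\<lambda>p. scale (c p) (z p)) 0"
proof -
  obtain f where f: "poly f 0 = 0" "\<And>p. c p = poly f (q powi (- (2 * int p)))"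
    using small_coeff_imp_poly[OF assms(1)] by blast
  show ?thesis using tends_poly_scale[OF assms(2), of f] by (simp add: f)
qed

text \<open>
  Each of the finitely many vectors that may occur has a limit, and a small coefficient multiplies
  this limit by the value \<open>0\<close> of a polynomial at \<open>t = 0\<close>.
\<close>

lemma asymp_zero_imp_tends:
  assumes "asymp_zero m z"
  shows "tends m z 0"
proof -
  obtain A B f g where AB: "B \<subseteq> Uplus \<times> Uminus"
    "\<forall>u\<in>A. small_coeff (f u)" "\<forall>w\<in>B. small_coeff (g w)"
    and z: "\<forall>p. 0 \<le> int p + m \<longrightarrow>
          z p = (\<Sum>u\<in>A. scale (f u p) (act (TL m p) (u * idem m) (tens xi eta)))
              + (\<Sum>(x, y)\<in>B. scale (g (x, y) p)
                   (tens (act (Lmod_omega p) x xi) (act (Lmod (nat (int p + m))) y eta)))"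
    using assms unfolding asymp_zero_def by blast
  have A: "tends m (\<lambda>p. scale (f u p) (act (TL m p) (u * idem m) (tens xi eta))) 0" if "u \<in> A" for u
  proof -
    have "u * idem m \<in> Udot_idem m" by (simp add: Udot_idem_iff mult.assoc uq_relations(6))
    then obtain L where "has_limit m (u * idem m) L" using limit_determines_element by blast
    then show ?thesis using AB(2) that by (auto simp: has_limit_def intro: tends_small_scale)
  qed
  have B: "tends m (\<lambda>p. case w of (x, y) \<Rightarrow> scale (g (x, y) p)
      (tens (act (Lmod_omega p) x xi) (act (Lmod (nat (int p + m))) y eta))) 0" if w: "w \<in> B" for w
  proof (cases w)
    case (Pair x y)
    then obtain L where "tends m (\<lambda>p. tens (act (Lmod_omega p) x xi) (act (Lmod (nat (int p + m))) y eta)) L"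
      using AB(1) w tens_act_tends by blast
    then show ?thesis using AB(3) w by (auto simp: Pair intro: tends_small_scale)
  qed
  have "tends m (\<lambda>p. (\<Sum>u\<in>A. scale (f u p) (act (TL m p) (u * idem m) (tens xi eta)))
              + (\<Sum>(x, y)\<in>B. scale (g (x, y) p)
                   (tens (act (Lmod_omega p) x xi) (act (Lmod (nat (int p + m))) y eta)))) (0 + 0)"
    using tends_sum[of A m _ "\<lambda>_. 0", OF A] tends_sum[of B m _ "\<lambda>_. 0", OF B]
    by (intro tends_add) simp_all
  then show ?thesis using z by (auto intro: tends_cong)
qed

lemma divE_in_Uplus: "divE a \<in> Uplus"
proof -
  have "uE ^ a \<in> subalgebra {uE}"
  proof (induction a)
    case 0
    show ?case using subalgebra.scal[of 1] by (simp add: scal_simps)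
  qed (auto intro: subalgebra.intros)
  then show ?thesis unfolding divE_def Uplus_def by (intro subalgebra.mult subalgebra.scal)
qed

lemma divF_in_Uminus: "divF b \<in> Uminus"
proof -
  have "uF ^ b \<in> subalgebra {uF}"
  proof (induction b)
    case 0
    show ?case using subalgebra.scal[of 1] by (simp add: scal_simps)
  qed (auto intro: subalgebra.intros)
  then show ?thesis unfolding divF_def Uminus_def by (intro subalgebra.mult subalgebra.scal)
qed

lemma inj_divE: "inj divE"
proof (rule injI)
  fix i j assume "divE i = divE j"
  then have "act (Lmod_omega (max i j)) (divE i) xi = act (Lmod_omega (max i j)) (divE j) xi" by simp
  then have "(bvec i :: nat \<Rightarrow>\<^sub>0 Qq) = bvec j" by (simp add: act_divE_xi)
  then have "lookup (bvec i) i = lookup (bvec j) i" by simp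
  then show "i = j" by (simp add: bvec_def lookup_single when_def split: if_splits)
qed

lemma inj_divF: "inj divF"
proof (rule injI)
  fix i j assume "divF i = divF j"
  then have "act (Lmod (max i j)) (divF i) eta = act (Lmod (max i j)) (divF j) eta" by simp
  then have "(bvec i :: nat \<Rightarrow>\<^sub>0 Qq) = bvec j" by (simp add: act_divF_eta)
  then have "lookup (bvec i) i = lookup (bvec j) i" by simp
  then show "i = j" by (simp add: bvec_def lookup_single when_def split: if_splits)
qed

text \<open>
  The vectors \<open>v\<^sub>i\<^sub>j\<close> are themselves of the form \<open>x \<xi> \<otimes> y \<eta>\<close>, so the coordinates
  of \<open>z p\<close> serve as the small coefficients.
\<close>

lemma tends_imp_asymp_zero:
  assumes "tends m z 0"
  shows "asymp_zero m z"
proof -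
  obtain c where c: "specialize 0 c = (0 :: nat \<times> nat \<Rightarrow>\<^sub>0 Qq)"
    "\<And>p. 0 \<le> int p + m \<Longrightarrow> z p = lin (tvec m p) (specialize (q powi (- (2 * int p))) c)"
    using assms by (auto simp: tends_def)
  \<comment> \<open>The coefficients are indexed by pairs \<open>(x, y)\<close> of algebra elements, so \<open>(i, j)\<close> has to be recovered
    from the pair of divided powers.\<close>
  define h where "h = map_prod divE divF"
  have inj: "inj h" unfolding h_def by (intro prod.inj_map inj_divE inj_divF)
  define g where "g w p = poly (Poly_Mapping.lookup c (inv h w)) (q powi (- (2 * int p)))" for w p
  have g: "small_coeff (g w)" for w
  proof -
    have "poly (Poly_Mapping.lookup c (inv h w)) 0 = 0"
      using c(1) by (metis lookup_specialize lookup_zero)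
    then show ?thesis unfolding g_def by (rule poly_imp_small_coeff)
  qed
  let ?B = "h ` Poly_Mapping.keys c"
  have "z p = (\<Sum>(x, y)\<in>?B. scale (g (x, y) p)
      (tens (act (Lmod_omega p) x xi) (act (Lmod (nat (int p + m))) y eta)))" if p: "0 \<le> int p + m" for p
  proof -
    have "z p = (\<Sum>k\<in>Poly_Mapping.keys c.
        scale (poly (Poly_Mapping.lookup c k) (q powi (- (2 * int p)))) (tvec m p k))"
      unfolding c(2)[OF p]
      by (subst lin_superset[of "Poly_Mapping.keys c"]) (auto simp: in_keys_iff)
    also have "\<dots> = (\<Sum>k\<in>Poly_Mapping.keys c. case h k of (x, y) \<Rightarrow> scale (g (x, y) p)
      (tens (act (Lmod_omega p) x xi) (act (Lmod (nat (int p + m))) y eta)))"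
    proof (rule sum.cong)
      fix k :: "nat \<times> nat"
      obtain i j where k: "k = (i, j)" by (cases k)
      have "inv h (divE i, divF j) = k" using inv_f_f[OF inj, of k] by (simp add: k h_def)
      then show "scale (poly (Poly_Mapping.lookup c k) (q powi (- (2 * int p)))) (tvec m p k) =
        (case h k of (x, y) \<Rightarrow> scale (g (x, y) p)
          (tens (act (Lmod_omega p) x xi) (act (Lmod (nat (int p + m))) y eta)))"
        using tens_divE_divF[OF p, of i j] by (simp add: h_def k g_def)
    qed simp
    finally show ?thesis by (simp add: sum.reindex[OF inj_on_subset[OF inj]])
  qed
  then show ?thesis unfolding asymp_zero_def
    by (intro exI[of _ "{}"] exI[of _ ?B] exI[of _ "\<lambda>_ _. 0"] exI[of _ g])
      (auto simp: g h_def divE_in_Uplus divF_in_Uminus)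
qed

lemma ww_eq_basis_lift: "ww m a b = basis_lift m a b"
proof -
  have iff: "asymp_zero m (\<lambda>p. act (TL m p) w (tens xi eta)
       - tens (act (Lmod_omega p) (divE a) xi) (act (Lmod (nat (int p + m))) (divF b) eta))
    \<longleftrightarrow> has_limit m w (bvec (a, b))" (is "asymp_zero m ?z \<longleftrightarrow> _") for w
  proof -
    have "asymp_zero m ?z \<longleftrightarrow> tends m ?z 0"
      using asymp_zero_imp_tends tends_imp_asymp_zero by blast
    also have "\<dots> \<longleftrightarrow> tends m (\<lambda>p. act (TL m p) w (tens xi eta) - tvec m p (a, b)) 0"
      by (auto elim!: tends_cong simp: tens_divE_divF)
    also have "\<dots> \<longleftrightarrow> has_limit m w (bvec (a, b))"
      using tends_add[OF _ tends_tvec, of m _ 0 "(a, b)"] tends_diff[OF _ tends_tvec, of m _ "bvec (a, b)" "(a, b)"]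
      unfolding has_limit_def by fastforce
    finally show ?thesis .
  qed
  have "basis_lift m a b \<in> Udot_idem m" by (simp add: Udot_idem_iff basis_lift_idem)
  then show ?thesis
    unfolding ww_def iff
    using has_limit_basis_lift Udot_idem_eqI by (intro the_equality) blast+
qed

section \<open>The straightening formulas\<close>

lemma divE_divF_straightening:
  "divE a * divF b * idem m =
    (\<Sum>s=0..min a b. scal (straight_coeff a b m s) * ww m (a - s) (b - s))"
  by (simp add: divE_divF_eq_sum_basis_lift ww_eq_basis_lift)

lemma divF_divE_straightening:
  "divF b * divE a * idem m =
    (\<Sum>s=0..min a b. scal (straight_coeff b a (- m) s) * ww m (a - s) (b - s))"
proof (rule Udot_idem_eqI[OF _ _ has_limit_divF_divE])
  show "divF b * divE a * idem m \<in> Udot_idem m"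
    by (simp add: Udot_idem_iff mult.assoc uq_relations(6))
  show "(\<Sum>s=0..min a b. scal (straight_coeff b a (- m) s) * ww m (a - s) (b - s)) \<in> Udot_idem m"
    by (simp add: Udot_idem_iff sum_distrib_right mult.assoc ww_eq_basis_lift basis_lift_idem)
  show "has_limit m (\<Sum>s=0..min a b. scal (straight_coeff b a (- m) s) * ww m (a - s) (b - s))
      (straight_sum (\<lambda>j i. bvec (i, j)) b a (- m))"
    unfolding straight_sum_def min.commute[of b a] ww_eq_basis_lift
    by (intro has_limit_sum has_limit_scal has_limit_basis_lift)
qed

theorem theorem3p7:
  fixes a b :: nat and m :: int
  shows "(m \<le> int b - int a \<longrightarrow>
      divE a * divF b * idem m =
        (\<Sum>s = 0..min a b.
           scal (q powi (- (int s)\<^sup>2 + int s * (int a - int b + m)) / qpoch s) * ww m (a - s) (b - s)))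
    \<and> (m \<ge> int b - int a \<longrightarrow>
      divF b * divE a * idem m =
        (\<Sum>s = 0..min a b.
           scal (q powi (- (int s)\<^sup>2 - int s * (int a - int b + m)) / qpoch s) * ww m (a - s) (b - s)))"
proof -
  have "- (int s)\<^sup>2 + int s * (int b - int a + - m) = - (int s)\<^sup>2 - int s * (int a - int b + m)" for s
    by (simp add: algebra_simps)
  then show ?thesis
    using divE_divF_straightening[of a b m] divF_divE_straightening[of b a m]
    by (simp only: straight_coeff_def simp_thms)
qed

end
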